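(* Let $\ell$ be a positive number, let $\Omega\subset\mathbb R^{n+1}_+$ be a backward time connected domain, and let $(x_0,t_0)\in\Omega$. Suppose that $v\in C^{m,2}_{x,t}(\overline{\Omega_\phi})$ solves the equation $$\partial_t^2v-A(x,\partial_x)v=0\quad\text{at }x=x_0\text{ and for all }t\in(0,\phi(t_0)).$$ Then the functions $K_0v\in C^{m,2}_{x,t}(\Omega)$ and $K_1v\in C^{m,2}_{x,t}(\Omega)$ satisfy $$\left(\partial_t^2-t^\ell A(x,\partial_x)\right)K_0v=a_\ell\,t^{\frac{\ell}{2}-1}\,\partial_tv(x,0)\quad\text{at }x=x_0\text{ for all }t\in(0,t_0),$$ $$\left(\partial_t^2-t^\ell A(x,\partial_x)\right)K_1v=b_\ell\,t^{\frac{\ell}{2}}\,\partial_tv(x,0)\quad\text{at }x=x_0\text{ for all }t\in(0,t_0),$$ respectively. They have at $x=x_0$ the initial values $$(K_0v)(x_0,0)=v(x_0,0),\quad (K_0v)_t(x_0,0)=0,\qquad (K_1v)(x_0,0)=0,\quad (K_1v)_t(x_0,0)=v(x_0,0).$$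
   Context: $\mathbb R^{n+1}_+=\{(x,t): x\in\mathbb R^n,\ t>0\}$. A set $\Omega\subseteq\overline{\mathbb R^{n+1}_+}$ is backward time (line-)connected (to $t=0$) if for every $(x,t)\in\Omega$ the segment $\{(x,s): s\in(0,t]\}$ is contained in $\Omega$. A domain is a connected open set. $\phi(t)=\frac{2}{\ell+2}t^{(\ell+2)/2}$, $\gamma=\frac{\ell}{2(\ell+2)}$. The $\phi$-image of $\Omega$ is $\Omega_\phi=\bigcup_{(x,t)\in\Omega}\{(x,\tau):\tau\in(0,\phi(t)]\}$. $A(x,\partial_x)=\sum_{|\alpha|\le m}a_\alpha(x)\partial_x^\alpha$ is a linear partial differential operator of order $m$ in $x$ with $C^\infty$ coefficients on the projection of $\Omega$ to $\mathbb R^n$. $C^{m,2}_{x,t}(\cdot)$ denotes functions continuous together with their partial derivatives up to order $m$ in $x$ and up to order $2$ in $t$ (on a closed set: extending continuously to it). Values at $t=0$ are understood by continuous extension. The operators are $$(K_0v)(x,t)=2^{2-2\gamma}\frac{\Gamma(2\gamma)}{\Gamma^2(\gamma)}\int_0^1v(x,\phi(t)s)(1-s^2)^{\gamma-1}ds,$$ $$(K_1v)(x,t)=t\,2^{2\gamma}\frac{\Gamma(2-2\gamma)}{\Gamma^2(1-\gamma)}\int_0^1v(x,\phi(t)s)(1-s^2)^{-\gamma}ds,$$ and the constants are $$a_\ell=2^{1-2\gamma}\frac{\ell\,\Gamma(2\gamma)}{2\gamma\,\Gamma^2(\gamma)},\qquad b_\ell=(\ell+2)2^{2\gamma-1}\frac{\Gamma(2-2\gamma)}{\Gamma^2(1-\gamma)}.$$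 *)

theory Defs
  imports "HOL-Analysis.Analysis"
begin

definition partial_deriv ::
  "'a::real_normed_vector \<Rightarrow> ('a \<Rightarrow> 'b::real_normed_vector) \<Rightarrow> 'a \<Rightarrow> 'b" where
  "partial_deriv u f p = vector_derivative (\<lambda>h. f (p + h *\<^sub>R u)) (at 0)"

text \<open>The head of the list is the direction of the outermost (last) differentiation.\<close>

abbreviation partial_derivs ::
  "'a::real_normed_vector list \<Rightarrow> ('a \<Rightarrow> 'b::real_normed_vector) \<Rightarrow> 'a \<Rightarrow> 'b" where
  "partial_derivs us f \<equiv> foldr partial_deriv us f"

text \<open>Below, \<open>S\<close> is always an open set, so the values of a function off \<open>S\<close> do not influence
  its partial derivatives at the points of \<open>S\<close>.\<close>

primrec partial_derivs_exist ::
  "'a::real_normed_vector set \<Rightarrow> 'a list \<Rightarrow> ('a \<Rightarrow> 'b::real_normed_vector) \<Rightarrow> bool" where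
  "partial_derivs_exist S [] f \<longleftrightarrow> True"
| "partial_derivs_exist S (u # us) f \<longleftrightarrow>
     partial_derivs_exist S us f \<and>
     (\<forall>p\<in>S. (\<lambda>h. partial_derivs us f (p + h *\<^sub>R u)) differentiable (at 0))"

definition C_infinity_on :: "(real ^ 'n) set \<Rightarrow> (real ^ 'n \<Rightarrow> 'b::real_normed_vector) \<Rightarrow> bool" where
  "C_infinity_on S f \<longleftrightarrow>
     (\<forall>is :: 'n list.
        partial_derivs_exist S (map (\<lambda>i. axis i 1) is) f \<and>
        continuous_on S (partial_derivs (map (\<lambda>i. axis i 1) is) f))"

definition x_dir :: "'n \<Rightarrow> (real ^ 'n) \<times> real" where
  "x_dir i = (axis i 1, 0)"

definition t_dir :: "(real ^ 'n) \<times> real" where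
  "t_dir = (0, 1)"

abbreviation t_deriv ::
  "((real ^ 'n) \<times> real \<Rightarrow> 'b::real_normed_vector) \<Rightarrow> (real ^ 'n) \<times> real \<Rightarrow> 'b" where
  "t_deriv \<equiv> partial_deriv t_dir"

text \<open>The derivatives controlled by \<open>C\<^sup>m\<^sup>,\<^sup>2\<close>: pure \<open>x\<close>-derivatives of order at most \<open>m\<close>, taken in
  any order, and pure \<open>t\<close>-derivatives of order at most \<open>2\<close>.\<close>

definition C_m_2_dirs :: "nat \<Rightarrow> ((real ^ 'n) \<times> real) list set" where
  "C_m_2_dirs m = {map x_dir is | is. length is \<le> m} \<union> {replicate j t_dir | j. j \<le> 2}"

definition C_m_2_on ::
  "nat \<Rightarrow> ((real ^ 'n) \<times> real) set \<Rightarrow> ((real ^ 'n) \<times> real \<Rightarrow> 'b::real_normed_vector) \<Rightarrow> bool" where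
  "C_m_2_on m S f \<longleftrightarrow>
     (\<forall>us \<in> C_m_2_dirs m. partial_derivs_exist S us f \<and> continuous_on S (partial_derivs us f))"

text \<open>The class on the closure of the open set \<open>S\<close>: each of the derivatives on \<open>S\<close> extends
  continuously to \<open>closure S\<close>.  The values of \<open>f\<close> itself off \<open>S\<close> are irrelevant.\<close>

definition C_m_2_on_closure ::
  "nat \<Rightarrow> ((real ^ 'n) \<times> real) set \<Rightarrow> ((real ^ 'n) \<times> real \<Rightarrow> 'b::real_normed_vector) \<Rightarrow> bool" where
  "C_m_2_on_closure m S f \<longleftrightarrow>
     C_m_2_on m S f \<and>
     (\<forall>us \<in> C_m_2_dirs m. \<exists>g. continuous_on (closure S) g \<and> (\<forall>p\<in>S. g p = partial_derivs us f p))"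

definition extended_value ::
  "'a::topological_space set \<Rightarrow> ('a \<Rightarrow> 'b::t2_space) \<Rightarrow> 'a \<Rightarrow> 'b" where
  "extended_value S f p = Lim (at p within S) f"

text \<open>An enumeration \<open>x\<^sub>1, \<dots>, x\<^sub>n\<close> of the coordinates.  It only serves to fix the order of
  differentiation in \<open>\<partial>\<^sub>x\<^sup>\<alpha>\<close>, which is immaterial for the functions of the above classes.\<close>

definition coordinates :: "'n::finite list" where
  "coordinates = (SOME is. distinct is \<and> set is = UNIV)"

definition multi_deriv ::
  "('n::finite \<Rightarrow> nat) \<Rightarrow> ((real ^ 'n) \<times> real \<Rightarrow> 'b::real_normed_vector) \<Rightarrow> (real ^ 'n) \<times> real \<Rightarrow> 'b" where
  "multi_deriv \<alpha> f =
     partial_derivs (concat (map (\<lambda>i. replicate (\<alpha> i) (x_dir i)) coordinates)) f"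

definition multi_indices :: "nat \<Rightarrow> ('n::finite \<Rightarrow> nat) set" where
  "multi_indices m = {\<alpha>. (\<Sum>i\<in>UNIV. \<alpha> i) \<le> m}"

definition diff_op ::
  "nat \<Rightarrow> (('n::finite \<Rightarrow> nat) \<Rightarrow> real ^ 'n \<Rightarrow> 'b::real_normed_field)
     \<Rightarrow> ((real ^ 'n) \<times> real \<Rightarrow> 'b) \<Rightarrow> (real ^ 'n) \<times> real \<Rightarrow> 'b" where
  "diff_op m a f p = (\<Sum>\<alpha>\<in>multi_indices m. a \<alpha> (fst p) * multi_deriv \<alpha> f p)"

definition upper_half_space :: "((real ^ 'n) \<times> real) set" where
  "upper_half_space = {(x, t). t > 0}"

definition backward_time_connected :: "((real ^ 'n) \<times> real) set \<Rightarrow> bool" where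
  "backward_time_connected \<Omega> \<longleftrightarrow>
     \<Omega> \<subseteq> closure upper_half_space \<and> (\<forall>(x, t)\<in>\<Omega>. {x} \<times> {0<..t} \<subseteq> \<Omega>)"

definition phi :: "real \<Rightarrow> real \<Rightarrow> real" where
  "phi l t = 2 / (l + 2) * t powr ((l + 2) / 2)"

definition gam :: "real \<Rightarrow> real" where
  "gam l = l / (2 * (l + 2))"

definition phi_image :: "real \<Rightarrow> ((real ^ 'n) \<times> real) set \<Rightarrow> ((real ^ 'n) \<times> real) set" where
  "phi_image l \<Omega> = (\<Union>(x, t)\<in>\<Omega>. {x} \<times> {0<..phi l t})"

definition K0 ::
  "real \<Rightarrow> ((real ^ 'n) \<times> real \<Rightarrow> 'b::euclidean_space) \<Rightarrow> (real ^ 'n) \<times> real \<Rightarrow> 'b" where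
  "K0 l v = (\<lambda>(x, t).
     (2 powr (2 - 2 * gam l) * Gamma (2 * gam l) / (Gamma (gam l))\<^sup>2) *\<^sub>R
     integral {0..1} (\<lambda>s. (1 - s\<^sup>2) powr (gam l - 1) *\<^sub>R v (x, phi l t * s)))"

definition K1 ::
  "real \<Rightarrow> ((real ^ 'n) \<times> real \<Rightarrow> 'b::euclidean_space) \<Rightarrow> (real ^ 'n) \<times> real \<Rightarrow> 'b" where
  "K1 l v = (\<lambda>(x, t).
     (t * 2 powr (2 * gam l) * Gamma (2 - 2 * gam l) / (Gamma (1 - gam l))\<^sup>2) *\<^sub>R
     integral {0..1} (\<lambda>s. (1 - s\<^sup>2) powr (- gam l) *\<^sub>R v (x, phi l t * s)))"

definition a_const :: "real \<Rightarrow> real" where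
  "a_const l = 2 powr (1 - 2 * gam l) * (l * Gamma (2 * gam l)) / (2 * gam l * (Gamma (gam l))\<^sup>2)"

definition b_const :: "real \<Rightarrow> real" where
  "b_const l = (l + 2) * 2 powr (2 * gam l - 1) * Gamma (2 - 2 * gam l) / (Gamma (1 - gam l))\<^sup>2"

end

theory Submission
  imports Defs
begin

text \<open>Both transforms have the form
  \<open>U(x, t) = \<kappa>(t) * (\<integral> w(s) * v(x, \<phi>(t) * s) ds)\<close> with \<open>s\<close> from \<open>0\<close> to \<open>1\<close> and
  \<open>w(s) = (1 - s\<^sup>2) powr (\<mu> - 1)\<close>, where \<open>\<kappa>\<close> is constant and \<open>\<mu> = \<gamma>\<close> for \<open>K0\<close>, while \<open>\<kappa>\<close> is a
  multiple of \<open>t\<close> and \<open>\<mu> = 1 - \<gamma>\<close> for \<open>K1\<close>.  Differentiation under the integral gives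

  \<^item> \<open>U\<^sub>t\<^sub>t = (2 * \<kappa>' * \<phi>' + \<kappa> * \<phi>'') * (\<integral> s * w * v\<^sub>t ds) + \<kappa> * \<phi>'\<^sup>2 * (\<integral> s\<^sup>2 * w * v\<^sub>t\<^sub>t ds)\<close>,
  \<^item> \<open>A U = \<kappa> * (\<integral> w * v\<^sub>t\<^sub>t ds)\<close>,

  the latter because \<open>A\<close> involves only \<open>x\<close>, and \<open>v\<^sub>t\<^sub>t = A v\<close> along the segment
  over \<open>x = x0\<close>.  Since
  \<open>\<phi>'\<^sup>2 = t powr l\<close>, the second derivatives of \<open>v\<close> enter \<open>U\<^sub>t\<^sub>t - t powr l * A U\<close> only through
  \<open>\<integral> (1 - s\<^sup>2) powr \<mu> * v\<^sub>t\<^sub>t ds\<close>.  Integration by parts in \<open>s\<close> turns this into the boundary value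
  \<open>v\<^sub>t(x, 0)\<close> and another multiple of \<open>\<integral> s * w * v\<^sub>t ds\<close>.  The choice of \<open>\<kappa>\<close> and \<open>\<mu>\<close> is the one
  for which the two multiples of this integral cancel, and the boundary value is the right-hand side
  (\<open>mean_transform_equation\<close>).  The initial values hold because the constants in \<open>K0\<close> and \<open>K1\<close>
  normalise the integral of the weight, which is a Beta integral
  (\<open>has_integral_one_minus_square_powr\<close>).

  The analytic difficulty is that the weight is unbounded at \<open>s = 1\<close>, and that \<open>v\<close> and its
  derivatives are given only on the open \<open>\<phi>\<close>-image of \<open>\<Omega>\<close>, whose segments end on the boundary.
  The remedy is to work with the continuous extensions to the closure.  The closure contains the
  complete segment below each of its points, and these segments are compact; hence all functions are
  bounded near them and dominated convergence applies.  This gives continuity of weighted means up to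
  the boundary (\<open>continuous_on_segment_mean\<close>) and differentiability inside
  (\<open>segment_mean_has_derivative\<close>).\<close>

section \<open>Differentiation under a weighted integral\<close>

text \<open>The weights of the transforms are unbounded near \<open>s = 1\<close>, so the Leibniz rule for jointly
  continuous integrands does not apply.  By the mean value inequality the difference quotients of
  \<open>F\<close> in \<open>h\<close> are bounded by the bound \<open>B\<close> of the derivative, so that \<open>B * norm (w s)\<close>
  dominates the difference quotients of the whole integrand.\<close>
lemma has_vector_derivative_integral_dominated:
  fixes F F' :: "real \<Rightarrow> 'a::euclidean_space \<Rightarrow> 'b::euclidean_space" and w :: "'a \<Rightarrow> real"
  assumes w: "w absolutely_integrable_on S" and "\<delta> > 0"
    and int: "\<And>h. \<bar>h\<bar> < \<delta> \<Longrightarrow> (\<lambda>s. w s *\<^sub>R F h s) integrable_on S"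
    and der: "\<And>h s. \<bar>h\<bar> < \<delta> \<Longrightarrow> s \<in> S \<Longrightarrow> ((\<lambda>h. F h s) has_vector_derivative F' h s) (at h)"
    and bound: "\<And>h s. \<bar>h\<bar> < \<delta> \<Longrightarrow> s \<in> S \<Longrightarrow> norm (F' h s) \<le> B"
  shows "((\<lambda>h. integral S (\<lambda>s. w s *\<^sub>R F h s)) has_vector_derivative
           integral S (\<lambda>s. w s *\<^sub>R F' 0 s)) (at 0)"
proof -
  define I where "I h = integral S (\<lambda>s. w s *\<^sub>R F h s)" for h
  define D where "D = integral S (\<lambda>s. w s *\<^sub>R F' 0 s)"
  have lip: "norm (F h s - F 0 s) \<le> B * \<bar>h\<bar>" if "\<bar>h\<bar> < \<delta>" "s \<in> S" for h s
  proof -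
    have "norm (F h s - F 0 s) \<le> B * norm (h - 0)"
    proof (rule differentiable_bound[where S = "{-\<delta><..<\<delta>}" and f' = "\<lambda>h k. k *\<^sub>R F' h s"])
      show "((\<lambda>h. F h s) has_derivative (\<lambda>k. k *\<^sub>R F' x s)) (at x within {-\<delta><..<\<delta>})"
        if "x \<in> {-\<delta><..<\<delta>}" for x
        using der[of x s] that \<open>s \<in> S\<close>
        by (auto simp: has_vector_derivative_def intro: has_derivative_at_withinI)
      show "onorm (\<lambda>k. k *\<^sub>R F' x s) \<le> B" if "x \<in> {-\<delta><..<\<delta>}" for x
        using bound[of x s] that \<open>s \<in> S\<close>
        by (intro onorm_le) (auto simp: mult.commute[of B] intro!: mult_left_mono)
    qed (use that in auto)
    then show ?thesis by simp
  qed
  have quotient: "(\<lambda>n. (1 / X n) *\<^sub>R (I (X n) - I 0)) \<longlonglongrightarrow> D"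
    if X: "\<And>n. X n \<in> {-\<delta><..<\<delta>} - {0}" "X \<longlonglongrightarrow> 0" for X
  proof -
    define q where "q n s = w s *\<^sub>R ((1 / X n) *\<^sub>R (F (X n) s - F 0 s))" for n s
    have q_eq: "q n s = (1 / X n) *\<^sub>R (w s *\<^sub>R F (X n) s - w s *\<^sub>R F 0 s)" for n s
      by (simp add: q_def algebra_simps)
    have Xd: "\<bar>X n\<bar> < \<delta>" "X n \<noteq> 0" for n
      using X(1)[of n] by auto
    have q_int: "q n integrable_on S" for n
      unfolding q_eq[abs_def] using Xd \<open>\<delta> > 0\<close>
      by (intro integrable_cmul integrable_diff int) auto
    have "(\<lambda>n. integral S (q n)) \<longlonglongrightarrow> integral S (\<lambda>s. w s *\<^sub>R F' 0 s)"
    proof (rule dominated_convergence(2)[OF q_int])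
      show "(\<lambda>s. B * norm (w s)) integrable_on S"
        using w by (intro integrable_on_mult_right) (simp add: absolutely_integrable_on_def)
      show "norm (q n s) \<le> B * norm (w s)" if "s \<in> S" for n s
      proof -
        have "norm (F (X n) s - F 0 s) / \<bar>X n\<bar> \<le> B"
          using lip[of "X n" s] Xd[of n] that by (simp add: divide_simps)
        then have "\<bar>w s\<bar> * (norm (F (X n) s - F 0 s) / \<bar>X n\<bar>) \<le> \<bar>w s\<bar> * B"
          by (intro mult_left_mono) auto
        then show ?thesis
          by (simp add: q_def mult.commute)
      qed
      show "(\<lambda>n. q n s) \<longlonglongrightarrow> w s *\<^sub>R F' 0 s" if "s \<in> S" for s
      proof -
        have "((\<lambda>h. F h s) has_derivative (\<lambda>k. k *\<^sub>R F' 0 s)) (at 0)"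
          using der[of 0 s] \<open>\<delta> > 0\<close> that by (simp add: has_vector_derivative_def)
        then have "((\<lambda>h. norm (F h s - F 0 s - h *\<^sub>R F' 0 s) / norm h) \<longlongrightarrow> 0) (at 0)"
          by (simp add: has_derivative_at)
        then have "(\<lambda>n. norm (F (X n) s - F 0 s - X n *\<^sub>R F' 0 s) / norm (X n)) \<longlonglongrightarrow> 0"
          using X Xd(2) unfolding tendsto_at_iff_sequentially by (auto simp: o_def)
        moreover have "norm (F (X n) s - F 0 s - X n *\<^sub>R F' 0 s) / norm (X n) =
            norm ((1 / X n) *\<^sub>R (F (X n) s - F 0 s) - F' 0 s)" for n
        proof -
          have "(1 / X n) *\<^sub>R (F (X n) s - F 0 s) - F' 0 s =
              (1 / X n) *\<^sub>R (F (X n) s - F 0 s - X n *\<^sub>R F' 0 s)"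
            using Xd(2)[of n] by (simp add: algebra_simps)
          then show ?thesis by simp
        qed
        ultimately have "(\<lambda>n. (1 / X n) *\<^sub>R (F (X n) s - F 0 s)) \<longlonglongrightarrow> F' 0 s"
          by (simp add: tendsto_norm_zero_iff LIM_zero_iff)
        then show ?thesis
          unfolding q_def by (intro tendsto_intros)
      qed
    qed
    moreover have "integral S (q n) = (1 / X n) *\<^sub>R (I (X n) - I 0)" for n
      unfolding q_eq[abs_def] I_def using Xd \<open>\<delta> > 0\<close>
      by (simp add: integral_diff int)
    ultimately show ?thesis by (simp add: D_def)
  qed
  \<comment> \<open>Dominated convergence is a statement about sequences, and the bounds hold for \<open>\<bar>h\<bar> < \<delta>\<close> only;
    restricting the limit to this interval makes every sequence satisfy them.\<close>
  have "((\<lambda>h. (1 / h) *\<^sub>R (I h - I 0)) \<longlongrightarrow> D) (at 0 within {-\<delta><..<\<delta>})"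
    unfolding tendsto_at_iff_sequentially using quotient by (auto simp: o_def)
  moreover have "at 0 within {-\<delta><..<\<delta>} = at (0::real)"
    using \<open>\<delta> > 0\<close> by (intro at_within_open) auto
  ultimately have "((\<lambda>h. norm ((1 / h) *\<^sub>R (I h - I 0) - D)) \<longlongrightarrow> 0) (at 0)"
    by (simp add: tendsto_norm_zero_iff LIM_zero_iff)
  moreover have "eventually (\<lambda>h. norm ((1 / h) *\<^sub>R (I h - I 0) - D) =
      norm (I (0 + h) - I 0 - h *\<^sub>R D) / norm h) (at 0)"
    unfolding eventually_at_filter
  proof (intro always_eventually allI impI)
    fix h :: real assume "h \<noteq> 0"
    then have "(1 / h) *\<^sub>R (I h - I 0) - D = (1 / h) *\<^sub>R (I h - I 0 - h *\<^sub>R D)"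
      by (simp add: algebra_simps)
    then show "norm ((1 / h) *\<^sub>R (I h - I 0) - D) = norm (I (0 + h) - I 0 - h *\<^sub>R D) / norm h"
      by simp
  qed
  ultimately have "((\<lambda>h. norm (I (0 + h) - I 0 - h *\<^sub>R D) / norm h) \<longlongrightarrow> 0) (at 0)"
    by (rule Lim_transform_eventually)
  then have "(I has_vector_derivative D) (at 0)"
    unfolding has_vector_derivative_def has_derivative_at
    by (simp add: bounded_linear_scaleR_left)
  then show ?thesis by (simp add: I_def[abs_def] D_def)
qed

section \<open>Weighted means over backward time segments\<close>

definition scale_time :: "real \<Rightarrow> 'a \<times> real \<Rightarrow> 'a \<times> real" where
  "scale_time s p = (fst p, snd p * s)"

definition time_starlike :: "('a \<times> real) set \<Rightarrow> bool" where
  "time_starlike D \<longleftrightarrow> (\<forall>p\<in>D. \<forall>s\<in>{0<..<1}. scale_time s p \<in> D)"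

definition extends_to_closure ::
    "'a::topological_space set \<Rightarrow> ('a \<Rightarrow> 'b::topological_space) \<Rightarrow> bool" where
  "extends_to_closure D g \<longleftrightarrow> (\<exists>G. continuous_on (closure D) G \<and> (\<forall>p\<in>D. G p = g p))"

text \<open>The open interval avoids the end \<open>s = 0\<close>, where \<open>scale_time s p\<close> leaves the open set on
  which \<open>g\<close> and its derivatives are under control.\<close>
definition segment_mean ::
    "(real \<Rightarrow> real) \<Rightarrow> ('a::euclidean_space \<times> real \<Rightarrow> 'b::euclidean_space) \<Rightarrow> 'a \<times> real \<Rightarrow> 'b" where
  "segment_mean w g p = integral {0<..<1} (\<lambda>s. w s *\<^sub>R g (scale_time s p))"

lemma continuous_on_scale_time [continuous_intros]:
  fixes f :: "'c::topological_space \<Rightarrow> 'a::topological_space \<times> real"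
  assumes "continuous_on A r" and "continuous_on A f"
  shows "continuous_on A (\<lambda>x. scale_time (r x) (f x))"
  unfolding scale_time_def by (intro continuous_intros assms)

text \<open>In the closure \<open>s\<close> may reach \<open>0\<close>.  Whole segments down to time \<open>0\<close> are therefore
  compact subsets of \<open>closure D\<close>, which is the source of all bounds below.\<close>
lemma scale_time_closure:
  fixes D :: "('a::topological_space \<times> real) set"
  assumes D: "time_starlike D" and p: "p \<in> closure D" and s: "s \<in> {0..1}"
  shows "scale_time s p \<in> closure D"
proof -
  have cl: "closure (D \<times> {0<..<1}) = closure D \<times> {0..1::real}"
    by (simp add: closure_Times)
  have "(\<lambda>z. scale_time (snd z) (fst z)) ` closure (D \<times> {0<..<1}) \<subseteq> closure D"
  proof (rule image_closure_subset)
    show "continuous_on (closure (D \<times> {0<..<1})) (\<lambda>z. scale_time (snd z) (fst z))"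
      by (intro continuous_intros)
    show "(\<lambda>z. scale_time (snd z) (fst z)) ` (D \<times> {0<..<1}) \<subseteq> closure D"
      using D closure_subset by (fastforce simp: time_starlike_def)
  qed auto
  then show ?thesis
    using p s unfolding cl by force
qed

lemma segment_integrand_absolutely_integrable:
  fixes G :: "'a::euclidean_space \<times> real \<Rightarrow> 'b::euclidean_space"
  assumes D: "time_starlike D" and w: "w absolutely_integrable_on {0<..<1}"
    and G: "continuous_on (closure D) G" and p: "p \<in> closure D"
  shows "(\<lambda>s. w s *\<^sub>R G (scale_time s p)) absolutely_integrable_on {0<..<1}"
proof -
  have cont: "continuous_on {0..1} (\<lambda>s. G (scale_time s p))"
    by (rule continuous_on_compose2[OF G])
      (auto intro!: continuous_intros scale_time_closure[OF D p])
  show ?thesis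
  proof (rule absolutely_integrable_bounded_measurable_product[where h = "\<lambda>g r. r *\<^sub>R g"])
    show "bilinear (\<lambda>(g::'b) r. r *\<^sub>R g)"
      by (auto simp: bilinear_def intro!: linearI simp: algebra_simps)
    show "(\<lambda>s. G (scale_time s p)) \<in> borel_measurable (lebesgue_on {0<..<1})"
      by (rule continuous_imp_measurable_on_sets_lebesgue)
        (auto intro: continuous_on_subset[OF cont])
    have "bounded ((\<lambda>s. G (scale_time s p)) ` {0..1})"
      by (intro compact_imp_bounded compact_continuous_image cont) auto
    then show "bounded ((\<lambda>s. G (scale_time s p)) ` {0<..<1})"
      by (rule bounded_subset) auto
  qed (use w in auto)
qed

lemma segment_mean_cong:
  assumes "time_starlike D" and "p \<in> D" and "\<And>q. q \<in> D \<Longrightarrow> f q = g q"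
  shows "segment_mean w f p = segment_mean w g p"
  unfolding segment_mean_def using assms
  by (intro integral_cong) (auto simp: time_starlike_def)

lemma bounded_on_time_scalings:
  fixes G :: "'a::euclidean_space \<times> real \<Rightarrow> 'b::euclidean_space"
  assumes D: "time_starlike D" and G: "continuous_on (closure D) G"
    and K: "compact K" "K \<subseteq> closure D"
  obtains B where "\<And>p s. p \<in> K \<Longrightarrow> s \<in> {0..1} \<Longrightarrow> norm (G (scale_time s p)) \<le> B"
proof -
  have "continuous_on (K \<times> {0..1}) (\<lambda>z. G (scale_time (snd z) (fst z)))"
    using K by (intro continuous_on_compose2[OF G])
      (auto intro!: continuous_intros scale_time_closure[OF D])
  then have "bounded ((\<lambda>z. G (scale_time (snd z) (fst z))) ` (K \<times> {0..1}))"
    using K by (intro compact_imp_bounded compact_continuous_image compact_Times) auto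
  then show ?thesis
    using that unfolding bounded_iff by force
qed

text \<open>Along a convergent sequence of points all the segments lie in one compact subset of the
  closure, on which \<open>G\<close> is bounded; dominated convergence does the rest.  Having continuity up to
  the boundary gives, in one stroke, the regularity inside and the initial values at time
  \<open>0\<close>.\<close>
lemma continuous_on_segment_mean:
  fixes G :: "'a::euclidean_space \<times> real \<Rightarrow> 'b::euclidean_space"
  assumes D: "time_starlike D" and w: "w absolutely_integrable_on {0<..<1}"
    and G: "continuous_on (closure D) G"
  shows "continuous_on (closure D) (segment_mean w G)"
proof (rule continuous_on_sequentiallyI)
  fix X p assume X: "\<forall>n. X n \<in> closure D" "p \<in> closure D" "X \<longlonglongrightarrow> p"
  obtain B where B: "\<And>q s. q \<in> insert p (range X) \<Longrightarrow> s \<in> {0..1} \<Longrightarrow> norm (G (scale_time s q)) \<le> B"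
    using bounded_on_time_scalings[OF D G compact_sequence_with_limit[OF X(3)]] X by auto
  show "(\<lambda>n. segment_mean w G (X n)) \<longlonglongrightarrow> segment_mean w G p"
    unfolding segment_mean_def
  proof (rule dominated_convergence(2))
    show "(\<lambda>s. w s *\<^sub>R G (scale_time s (X n))) integrable_on {0<..<1}" for n
      using segment_integrand_absolutely_integrable[OF D w G] X
      by (auto simp: absolutely_integrable_on_def)
    show "(\<lambda>s. norm (w s) * B) integrable_on {0<..<1}"
      using w by (intro integrable_on_mult_left) (simp add: absolutely_integrable_on_def)
    show "norm (w s *\<^sub>R G (scale_time s (X n))) \<le> norm (w s) * B" if "s \<in> {0<..<1}" for n s
      using B[of "X n" s] that by (auto intro: mult_left_mono)
    show "(\<lambda>n. w s *\<^sub>R G (scale_time s (X n))) \<longlonglongrightarrow> w s *\<^sub>R G (scale_time s p)"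
      if "s \<in> {0<..<1}" for s
    proof (intro tendsto_intros continuous_within_tendsto_compose'[where f = G])
      show "continuous (at (scale_time s p) within closure D) G"
        using G scale_time_closure[OF D X(2), of s] that
        by (auto simp: continuous_on_eq_continuous_within)
      show "scale_time s (X n) \<in> closure D" for n
        using scale_time_closure[OF D, of "X n" s] X that by auto
      show "(\<lambda>n. scale_time s (X n)) \<longlonglongrightarrow> scale_time s p"
        unfolding scale_time_def by (intro tendsto_intros X)
    qed
  qed
qed

lemma segment_mean_extends:
  fixes g :: "'a::euclidean_space \<times> real \<Rightarrow> 'b::euclidean_space"
  assumes D: "time_starlike D" and w: "w absolutely_integrable_on {0<..<1}"
    and g: "extends_to_closure D g"
  shows "extends_to_closure D (segment_mean w g)"
proof -
  obtain G where G: "continuous_on (closure D) G" "\<forall>p\<in>D. G p = g p"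
    using g by (auto simp: extends_to_closure_def)
  show ?thesis
    unfolding extends_to_closure_def
    by (rule exI[of _ "segment_mean w G"])
      (use G continuous_on_segment_mean[OF D w] segment_mean_cong[OF D, of _ G g] in blast)
qed

lemma segment_integrand_integrable:
  fixes g :: "'a::euclidean_space \<times> real \<Rightarrow> 'b::euclidean_space"
  assumes D: "time_starlike D" and w: "w absolutely_integrable_on {0<..<1}"
    and g: "extends_to_closure D g" and p: "p \<in> D"
  shows "(\<lambda>s. w s *\<^sub>R g (scale_time s p)) integrable_on {0<..<1}"
proof -
  obtain G where G: "continuous_on (closure D) G" "\<forall>p\<in>D. G p = g p"
    using g by (auto simp: extends_to_closure_def)
  have "(\<lambda>s. w s *\<^sub>R G (scale_time s p)) integrable_on {0<..<1}"
    using segment_integrand_absolutely_integrable[OF D w G(1), of p] p closure_subset[of D]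
    by (auto simp: absolutely_integrable_on_def)
  then show ?thesis
    by (rule integrable_eq) (use G(2) D p in \<open>auto simp: time_starlike_def\<close>)
qed

text \<open>Letting \<open>u\<close> be an eigenvector of all time scalings covers space and time derivatives at
  once: scaling a line in direction \<open>u\<close> gives a line in the same direction, run through with
  speed \<open>c s\<close>.  For space directions \<open>c s = 1\<close>, for the time direction \<open>c s = s\<close>; this is where
  the additional factor \<open>s\<close> in the weight of every time derivative comes from.\<close>
lemma segment_mean_has_derivative:
  fixes g :: "'a::euclidean_space \<times> real \<Rightarrow> 'b::euclidean_space"
  assumes D: "time_starlike D" and "open D"
    and w: "w absolutely_integrable_on {0<..<1}"
    and u: "\<And>s. s \<in> {0<..<1} \<Longrightarrow> scale_time s u = c s *\<^sub>R u"
    and c: "\<And>s. s \<in> {0<..<1} \<Longrightarrow> \<bar>c s\<bar> \<le> 1"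
    and g: "extends_to_closure D g" and g': "extends_to_closure D (partial_deriv u g)"
    and diff: "\<And>p. p \<in> D \<Longrightarrow> (\<lambda>h. g (p + h *\<^sub>R u)) differentiable (at 0)"
    and p: "p \<in> D"
  shows "((\<lambda>h. segment_mean w g (p + h *\<^sub>R u)) has_vector_derivative
           segment_mean (\<lambda>s. c s * w s) (partial_deriv u g) p) (at 0)"
proof -
  obtain G' where G': "continuous_on (closure D) G'" "\<forall>p\<in>D. G' p = partial_deriv u g p"
    using g' by (auto simp: extends_to_closure_def)
  have "open ((\<lambda>h. p + h *\<^sub>R u) -` D)"
    by (intro continuous_open_vimage continuous_intros \<open>open D\<close>)
  moreover have "0 \<in> (\<lambda>h. p + h *\<^sub>R u) -` D"
    using p by simp
  ultimately obtain \<delta> where "\<delta> > 0" and \<delta>: "cball 0 \<delta> \<subseteq> (\<lambda>h. p + h *\<^sub>R u) -` D"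
    by (meson open_contains_cball)
  have line: "p + h *\<^sub>R u \<in> D" if "\<bar>h\<bar> \<le> \<delta>" for h
    using \<delta> that by (auto simp: subset_iff)
  obtain B where B: "\<And>q s. q \<in> (\<lambda>h. p + h *\<^sub>R u) ` {-\<delta>..\<delta>} \<Longrightarrow> s \<in> {0..1}
      \<Longrightarrow> norm (G' (scale_time s q)) \<le> B"
  proof (rule bounded_on_time_scalings[OF D G'(1)])
    show "compact ((\<lambda>h. p + h *\<^sub>R u) ` {-\<delta>..\<delta>})"
      by (intro compact_continuous_image continuous_intros) auto
    show "(\<lambda>h. p + h *\<^sub>R u) ` {-\<delta>..\<delta>} \<subseteq> closure D"
      using line closure_subset[of D] by (force simp: abs_le_iff)
  qed blast
  have in_D: "scale_time s (p + h *\<^sub>R u) \<in> D" if "\<bar>h\<bar> \<le> \<delta>" "s \<in> {0<..<1}" for h s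
    using D line that by (auto simp: time_starlike_def)
  have scaled: "scale_time s (p + h *\<^sub>R u) = scale_time s p + (h * c s) *\<^sub>R u"
    if "s \<in> {0<..<1}" for s h
  proof -
    have "scale_time s (p + h *\<^sub>R u) = scale_time s p + h *\<^sub>R scale_time s u"
      by (simp add: scale_time_def algebra_simps)
    then show ?thesis by (simp add: u[OF that])
  qed
  have "((\<lambda>h. integral {0<..<1} (\<lambda>s. w s *\<^sub>R g (scale_time s (p + h *\<^sub>R u)))) has_vector_derivative
      integral {0<..<1} (\<lambda>s. w s *\<^sub>R (c s *\<^sub>R partial_deriv u g (scale_time s (p + 0 *\<^sub>R u))))) (at 0)"
  proof (rule has_vector_derivative_integral_dominated[OF w \<open>\<delta> > 0\<close>])
    show "(\<lambda>s. w s *\<^sub>R g (scale_time s (p + h *\<^sub>R u))) integrable_on {0<..<1}" if "\<bar>h\<bar> < \<delta>" for h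
      using segment_integrand_integrable[OF D w g] line that by auto
  next
    fix h s :: real assume h: "\<bar>h\<bar> < \<delta>" and s: "s \<in> {0<..<1}"
    define q where "q = scale_time s (p + h *\<^sub>R u)"
    have q: "q \<in> D" using in_D h s by (auto simp: q_def)
    \<comment> \<open>The base point \<open>0\<close> is written as the value at \<open>h\<close> of the inner function of the chain rule.\<close>
    have "((\<lambda>k. g (q + k *\<^sub>R u)) has_vector_derivative partial_deriv u g q) (at (c s * (h - h)))"
      using diff[OF q] by (simp add: partial_deriv_def vector_derivative_works)
    moreover have "((\<lambda>k. c s * (k - h)) has_vector_derivative c s) (at h)"
      by (auto intro!: derivative_eq_intros simp flip: has_real_derivative_iff_has_vector_derivative)
    ultimately have "((\<lambda>k. g (q + k *\<^sub>R u)) \<circ> (\<lambda>k. c s * (k - h)) has_vector_derivative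
        c s *\<^sub>R partial_deriv u g q) (at h)"
      by (rule vector_diff_chain_at[rotated])
    moreover have "(\<lambda>k. g (q + k *\<^sub>R u)) \<circ> (\<lambda>k. c s * (k - h)) = (\<lambda>k. g (scale_time s (p + k *\<^sub>R u)))"
      unfolding q_def scaled[OF s] by (simp add: fun_eq_iff algebra_simps)
    ultimately show "((\<lambda>h. g (scale_time s (p + h *\<^sub>R u))) has_vector_derivative
        c s *\<^sub>R partial_deriv u g (scale_time s (p + h *\<^sub>R u))) (at h)"
      by (simp add: q_def)
    have "norm (G' q) \<le> B"
      unfolding q_def by (rule B[OF imageI]) (use h s in auto)
    then have "norm (partial_deriv u g q) \<le> B"
      using G'(2) q by simp
    then have "\<bar>c s\<bar> * norm (partial_deriv u g q) \<le> 1 * B"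
      using c[OF s] by (intro mult_mono) auto
    then show "norm (c s *\<^sub>R partial_deriv u g (scale_time s (p + h *\<^sub>R u))) \<le> B"
      by (simp add: q_def)
  qed
  then show ?thesis
    by (simp add: segment_mean_def mult.commute)
qed

section \<open>The weights \<open>(1 - s\<^sup>2) powr (\<mu> - 1)\<close>\<close>

text \<open>The substitution \<open>t = (1 + s) / 2\<close> turns the symmetric Beta integral \<open>Beta \<mu> \<mu>\<close> into the
  integral of the even weight over \<open>{-1..1}\<close>, of which half is taken.  With
  \<open>\<mu> = \<gamma>\<close> and \<open>\<mu> = 1 - \<gamma>\<close> the values are the reciprocals of the constant factors in \<open>K0\<close>
  and \<open>K1\<close>.\<close>
lemma has_integral_one_minus_square_powr:
  fixes \<mu> :: real
  assumes "\<mu> > 0"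
  shows "((\<lambda>s. (1 - s\<^sup>2) powr (\<mu> - 1)) has_integral
           2 powr (2 * \<mu> - 2) * (Gamma \<mu>)\<^sup>2 / Gamma (2 * \<mu>)) {0<..<1}"
proof -
  define g where "g s = ((1 + s) / 2) powr (\<mu> - 1) * ((1 - s) / 2) powr (\<mu> - 1)" for s :: real
  have "((\<lambda>t. t powr (\<mu> - 1) * (1 - t) powr (\<mu> - 1)) has_integral Beta \<mu> \<mu>) (cbox 0 1)"
    using has_integral_Beta_real[OF assms assms] by simp
  from has_integral_affinity'[OF this, of "1/2" "1/2"]
  have g: "(g has_integral 2 * Beta \<mu> \<mu>) {-1..1}"
    by (simp add: g_def[abs_def] field_simps)
  have "g integrable_on {0..1}"
    by (rule integrable_subinterval_real[OF has_integral_integrable[OF g]]) auto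
  then obtain J where J: "(g has_integral J) {0..1}"
    by blast
  have "((\<lambda>s. g (- s)) has_integral J) {-1..-0}"
    using J by (subst has_integral_reflect_real)
  then have "(g has_integral J) {-1..0}"
    by (simp add: g_def[abs_def] mult.commute)
  then have "(g has_integral J + J) {-1..1}"
    by (rule has_integral_combine[rotated 2, OF _ J]) auto
  from has_integral_unique[OF this g] have "J = Beta \<mu> \<mu>"
    by simp
  then have "((\<lambda>s. 2 powr (2 * \<mu> - 2) * g s) has_integral 2 powr (2 * \<mu> - 2) * Beta \<mu> \<mu>) {0<..<1}"
    using J by (intro has_integral_mult_right) (simp add: has_integral_Icc_iff_Ioo)
  moreover have "2 powr (2 * \<mu> - 2) * g s = (1 - s\<^sup>2) powr (\<mu> - 1)" if "s \<in> {0<..<1}" for s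
  proof -
    have "(2::real) powr (2 * \<mu> - 2) = (2 * 2) powr (\<mu> - 1)"
      by (simp only: powr_mult flip: powr_add) (simp add: algebra_simps)
    moreover have "g s = (((1 + s) / 2) * ((1 - s) / 2)) powr (\<mu> - 1)"
      unfolding g_def using that by (subst powr_mult) auto
    ultimately have "2 powr (2 * \<mu> - 2) * g s = ((2 * 2) * (((1 + s) / 2) * ((1 - s) / 2))) powr (\<mu> - 1)"
      by (simp only: powr_mult)
    also have "(2 * 2) * (((1 + s) / 2) * ((1 - s) / 2)) = 1 - s\<^sup>2"
      by (simp add: field_simps power2_eq_square)
    finally show ?thesis .
  qed
  ultimately have "((\<lambda>s. (1 - s\<^sup>2) powr (\<mu> - 1)) has_integral 2 powr (2 * \<mu> - 2) * Beta \<mu> \<mu>) {0<..<1}"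
    by (rule has_integral_eq[rotated])
  then show ?thesis
    by (simp add: Beta_def power2_eq_square)
qed

lemma one_minus_square_powr_absolutely_integrable:
  fixes \<mu> :: real
  assumes "\<mu> > 0"
  shows "(\<lambda>s. (1 - s\<^sup>2) powr (\<mu> - 1)) absolutely_integrable_on {0<..<1}"
  using has_integral_one_minus_square_powr[OF assms]
  by (intro nonnegative_absolutely_integrable_1) auto

lemma absolutely_integrable_times_variable:
  fixes w :: "real \<Rightarrow> real"
  assumes "w absolutely_integrable_on {0<..<1}"
  shows "(\<lambda>s. s * w s) absolutely_integrable_on {0<..<1}"
proof (rule absolutely_integrable_bounded_measurable_product_real[OF _ _ _ assms])
  show "(\<lambda>s::real. s) \<in> borel_measurable (lebesgue_on {0<..<1})"
    by (rule continuous_imp_measurable_on_sets_lebesgue) auto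
  show "bounded ((\<lambda>s::real. s) ` {0<..<1})"
    by (simp add: bounded_Ioo)
qed auto

text \<open>The function \<open>(1 - s\<^sup>2) powr \<mu>\<close> is continuous on \<open>{0..1}\<close>, vanishes at \<open>1\<close>, and its derivative
  is integrable, being \<open>- 2 * \<mu> * s\<close> times the weight with exponent \<open>\<mu> - 1\<close>.  Hence the only
  boundary term comes from \<open>s = 0\<close>: the value of \<open>g\<close> at time \<open>0\<close>, which only its extension \<open>G\<close>
  provides.  With \<open>t_deriv v\<close> for \<open>g\<close>, this term becomes the right-hand side of the two
  equations.\<close>
lemma segment_mean_integration_by_parts:
  fixes g :: "(real ^ 'n) \<times> real \<Rightarrow> 'b::euclidean_space"
  assumes D: "time_starlike D" and "\<mu> > 0" and p: "p \<in> D"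
    and G: "continuous_on (closure D) G" "\<And>q. q \<in> D \<Longrightarrow> G q = g q"
    and g': "extends_to_closure D (t_deriv g)"
    and diff: "\<And>q. q \<in> D \<Longrightarrow> (\<lambda>h. g (q + h *\<^sub>R t_dir)) differentiable (at 0)"
  shows "snd p *\<^sub>R segment_mean (\<lambda>s. (1 - s\<^sup>2) powr \<mu>) (t_deriv g) p =
    (2 * \<mu>) *\<^sub>R segment_mean (\<lambda>s. s * (1 - s\<^sup>2) powr (\<mu> - 1)) g p - G (fst p, 0)"
proof -
  have in_D: "scale_time s p \<in> D" if "s \<in> {0<..<1}" for s
    using D p that by (auto simp: time_starlike_def)
  have p': "p \<in> closure D" using p closure_subset by auto
  define P where "P s = (1 - s\<^sup>2) powr \<mu> *\<^sub>R G (scale_time s p)" for s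
  define P' where "P' s = snd p *\<^sub>R ((1 - s\<^sup>2) powr \<mu> *\<^sub>R t_deriv g (scale_time s p))
      - (2 * \<mu>) *\<^sub>R ((s * (1 - s\<^sup>2) powr (\<mu> - 1)) *\<^sub>R g (scale_time s p))" for s
  have "(P' has_integral (P 1 - P 0)) {0..1}"
  proof (rule fundamental_theorem_of_calculus_interior)
    have "continuous_on {0..1} (\<lambda>s. G (scale_time s p))"
      by (rule continuous_on_compose2[OF G(1)])
        (auto intro!: continuous_intros scale_time_closure[OF D p'])
    moreover have "continuous_on {0..1} (\<lambda>s::real. (1 - s\<^sup>2) powr \<mu>)"
      using \<open>\<mu> > 0\<close>
      by (intro continuous_on_powr' continuous_intros) (auto simp: power2_eq_square mult_le_one)
    ultimately show "continuous_on {0..1} P"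
      unfolding P_def by (rule continuous_on_scaleR[rotated])
  next
    fix s :: real assume s: "s \<in> {0<..<1}"
    have pos: "1 - s\<^sup>2 > 0" using s by (simp add: abs_square_less_1)
    define q where "q = scale_time s p"
    have q: "q \<in> D" using in_D s by (auto simp: q_def)
    \<comment> \<open>The base point \<open>0\<close> is written as the value at \<open>s\<close> of the inner function of the chain rule.\<close>
    have "((\<lambda>k. g (q + k *\<^sub>R t_dir)) has_vector_derivative t_deriv g q) (at (snd p * (s - s)))"
      using diff[OF q] by (simp add: partial_deriv_def vector_derivative_works)
    moreover have "((\<lambda>r. snd p * (r - s)) has_vector_derivative snd p) (at s)"
      by (auto intro!: derivative_eq_intros simp flip: has_real_derivative_iff_has_vector_derivative)
    ultimately have "((\<lambda>k. g (q + k *\<^sub>R t_dir)) \<circ> (\<lambda>r. snd p * (r - s)) has_vector_derivative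
        snd p *\<^sub>R t_deriv g q) (at s)"
      by (rule vector_diff_chain_at[rotated])
    moreover have "(\<lambda>k. g (q + k *\<^sub>R t_dir)) \<circ> (\<lambda>r. snd p * (r - s)) = (\<lambda>r. g (scale_time r p))"
      by (simp add: q_def fun_eq_iff scale_time_def t_dir_def algebra_simps)
    ultimately have g_der: "((\<lambda>r. g (scale_time r p)) has_vector_derivative snd p *\<^sub>R t_deriv g q) (at s)"
      by simp
    have "((\<lambda>r. (1 - r\<^sup>2) powr \<mu>) has_real_derivative - (2 * \<mu>) * (s * (1 - s\<^sup>2) powr (\<mu> - 1))) (at s)"
      using pos by (auto intro!: derivative_eq_intros simp: powr_diff)
    then have "((\<lambda>r. (1 - r\<^sup>2) powr \<mu> *\<^sub>R g (scale_time r p)) has_vector_derivative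
        (1 - s\<^sup>2) powr \<mu> *\<^sub>R (snd p *\<^sub>R t_deriv g q) + (- (2 * \<mu>) * (s * (1 - s\<^sup>2) powr (\<mu> - 1))) *\<^sub>R g q) (at s)"
      using g_der unfolding q_def by (intro has_vector_derivative_scaleR) auto
    then have "((\<lambda>r. (1 - r\<^sup>2) powr \<mu> *\<^sub>R g (scale_time r p)) has_vector_derivative P' s) (at s)"
      by (simp add: P'_def q_def algebra_simps)
    then show "(P has_vector_derivative P' s) (at s)"
      by (rule has_vector_derivative_transform_within_open[where S = "{0<..<1}"])
        (use s G(2) in_D in \<open>auto simp: P_def\<close>)
  qed simp
  then have "integral {0<..<1} P' = - G (fst p, 0)"
    by (auto simp: has_integral_Icc_iff_Ioo P_def scale_time_def dest!: integral_unique)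
  moreover have "integral {0<..<1} P' =
      snd p *\<^sub>R segment_mean (\<lambda>s. (1 - s\<^sup>2) powr \<mu>) (t_deriv g) p
      - (2 * \<mu>) *\<^sub>R segment_mean (\<lambda>s. s * (1 - s\<^sup>2) powr (\<mu> - 1)) g p"
  proof -
    have g: "extends_to_closure D g"
      using G by (auto simp: extends_to_closure_def)
    have "(\<lambda>s. (1 - s\<^sup>2) powr \<mu> *\<^sub>R t_deriv g (scale_time s p)) integrable_on {0<..<1}"
      using one_minus_square_powr_absolutely_integrable[of "\<mu> + 1"] \<open>\<mu> > 0\<close>
      by (intro segment_integrand_integrable[OF D _ g' p]) auto
    moreover have "(\<lambda>s. (s * (1 - s\<^sup>2) powr (\<mu> - 1)) *\<^sub>R g (scale_time s p)) integrable_on {0<..<1}"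
      by (intro segment_integrand_integrable[OF D _ g p] absolutely_integrable_times_variable
          one_minus_square_powr_absolutely_integrable \<open>\<mu> > 0\<close>)
    ultimately show ?thesis
      unfolding P'_def segment_mean_def
      by (simp add: integral_diff integrable_cmul del: scaleR_scaleR)
  qed
  ultimately show ?thesis
    by (simp add: algebra_simps)
qed

section \<open>The change of the time variable\<close>

lemma phi_pos: "l > 0 \<Longrightarrow> t > 0 \<Longrightarrow> phi l t > 0"
  by (simp add: phi_def)

lemma phi_less: "l > 0 \<Longrightarrow> 0 < s \<Longrightarrow> s < t \<Longrightarrow> phi l s < phi l t"
  by (simp add: phi_def divide_strict_right_mono powr_less_mono2)

lemma has_real_derivative_phi:
  assumes "l > 0" and "t > 0"
  shows "(phi l has_real_derivative t powr (l / 2)) (at t)"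
proof -
  have "((\<lambda>t. 2 / (l + 2) * t powr ((l + 2) / 2)) has_real_derivative
      2 / (l + 2) * ((l + 2) / 2 * t powr ((l + 2) / 2 - 1))) (at t)"
    using assms by (auto intro!: derivative_eq_intros)
  moreover have "2 / (l + 2) * ((l + 2) / 2 * t powr ((l + 2) / 2 - 1)) = t powr (l / 2)"
    using assms by (simp add: field_simps)
  ultimately show ?thesis
    by (simp add: phi_def[abs_def])
qed

lemma tendsto_phi_at_0: "l > 0 \<Longrightarrow> (phi l \<longlongrightarrow> 0) (at_right 0)"
  unfolding phi_def[abs_def]
  by (auto intro!: tendsto_eq_intros eventually_at_rightI[of 0 1])

lemma time_starlike_phi_image:
  fixes \<Omega> :: "((real ^ 'n) \<times> real) set"
  shows "time_starlike (phi_image l \<Omega>)"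
  unfolding time_starlike_def
proof (intro ballI)
  fix p :: "(real ^ 'n) \<times> real" and s :: real
  assume p: "p \<in> phi_image l \<Omega>" and s: "s \<in> {0<..<1}"
  then obtain t where t: "(fst p, t) \<in> \<Omega>" "0 < snd p" "snd p \<le> phi l t"
    by (auto simp: phi_image_def)
  have "snd p * s \<le> snd p" using s t by (simp add: mult_left_le)
  then have "snd p * s \<le> phi l t" using t by linarith
  with t s show "scale_time s p \<in> phi_image l \<Omega>"
    by (auto simp: phi_image_def scale_time_def intro!: bexI[OF _ t(1)])
qed

text \<open>Backward connectedness identifies the \<open>\<phi>\<close>-image with the preimage of \<open>\<Omega>\<close> under the
  inverse \<open>\<psi>\<close> of the increasing function \<open>\<phi>\<close>.\<close>
lemma open_phi_image:
  fixes \<Omega> :: "((real ^ 'n) \<times> real) set"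
  assumes "l > 0" and "open \<Omega>" and up: "\<Omega> \<subseteq> upper_half_space" and bw: "backward_time_connected \<Omega>"
  shows "open (phi_image l \<Omega>)"
proof -
  define \<psi> where "\<psi> \<tau> = ((l + 2) / 2 * \<tau>) powr (2 / (l + 2))" for \<tau> :: real
  have phi_psi: "phi l (\<psi> \<tau>) = \<tau>" if "\<tau> > 0" for \<tau>
  proof -
    have "\<psi> \<tau> powr ((l + 2) / 2) = ((l + 2) / 2 * \<tau>) powr 1"
      unfolding \<psi>_def powr_powr using \<open>l > 0\<close> by (intro arg_cong2[where f = "(powr)"]) auto
    also have "\<dots> = (l + 2) / 2 * \<tau>"
      using that \<open>l > 0\<close> by simp
    finally have "\<psi> \<tau> powr ((l + 2) / 2) = (l + 2) / 2 * \<tau>" .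
    then show ?thesis
      using \<open>l > 0\<close> unfolding phi_def by (simp only:) simp
  qed
  have psi_pos: "\<psi> \<tau> > 0" if "\<tau> > 0" for \<tau>
    using that \<open>l > 0\<close> by (simp add: \<psi>_def)
  have "phi_image l \<Omega> = (UNIV \<times> {0<..}) \<inter> (\<lambda>p. (fst p, \<psi> (snd p))) -` \<Omega>"
  proof (intro set_eqI iffI)
    fix p :: "(real ^ 'n) \<times> real" assume "p \<in> phi_image l \<Omega>"
    then obtain t where t: "(fst p, t) \<in> \<Omega>" "0 < snd p" "snd p \<le> phi l t"
      by (auto simp: phi_image_def)
    have "\<psi> (snd p) \<le> t"
    proof (rule ccontr)
      assume "\<not> \<psi> (snd p) \<le> t"
      moreover have "t > 0" using t up by (auto simp: upper_half_space_def)
      ultimately have "phi l t < phi l (\<psi> (snd p))"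
        using phi_less \<open>l > 0\<close> by auto
      then show False using t phi_psi by auto
    qed
    then have "(fst p, \<psi> (snd p)) \<in> \<Omega>"
      using bw t(1) psi_pos[OF t(2)] by (fastforce simp: backward_time_connected_def)
    then show "p \<in> (UNIV \<times> {0<..}) \<inter> (\<lambda>p. (fst p, \<psi> (snd p))) -` \<Omega>"
      using t by (cases p) auto
  next
    fix p :: "(real ^ 'n) \<times> real" assume "p \<in> (UNIV \<times> {0<..}) \<inter> (\<lambda>p. (fst p, \<psi> (snd p))) -` \<Omega>"
    then show "p \<in> phi_image l \<Omega>"
      using phi_psi by (cases p) (force simp: phi_image_def)
  qed
  moreover have "open ((UNIV \<times> {0<..}) \<inter> (\<lambda>p. (fst p, \<psi> (snd p))) -` \<Omega>)"
  proof (rule continuous_open_preimage)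
    show "continuous_on (UNIV \<times> {0<..}) (\<lambda>p. (fst p, \<psi> (snd p)))"
      using \<open>l > 0\<close> unfolding \<psi>_def by (intro continuous_intros) auto
  qed (auto intro: open_Times \<open>open \<Omega>\<close>)
  ultimately show ?thesis by simp
qed

section \<open>Derivatives of the transforms\<close>

text \<open>Both \<open>K0\<close> and \<open>K1\<close> have this form, with \<open>\<kappa>\<close> a constant and a multiple of \<open>t\<close>,
  respectively.  The form is reproduced by differentiation: a space derivative acts on \<open>g\<close> alone, a
  time derivative gives a sum of two such expressions.\<close>
definition mean_transform ::
    "real \<Rightarrow> (real \<Rightarrow> real) \<Rightarrow> (real \<Rightarrow> real) \<Rightarrow> ((real ^ 'n) \<times> real \<Rightarrow> 'b::euclidean_space)
      \<Rightarrow> (real ^ 'n) \<times> real \<Rightarrow> 'b" where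
  "mean_transform l \<kappa> w g p = \<kappa> (snd p) *\<^sub>R segment_mean w g (fst p, phi l (snd p))"

text \<open>Iterated partial derivatives are computed only at the points of an open set, so each step has
  to replace the previous derivative by its formula near the point.\<close>
lemma has_vector_derivative_line_cong:
  fixes f g :: "'a::real_normed_vector \<Rightarrow> 'b::real_normed_vector"
  assumes "open S" and "p \<in> S" and "\<And>q. q \<in> S \<Longrightarrow> f q = g q"
    and "((\<lambda>h. g (p + h *\<^sub>R u)) has_vector_derivative d) (at 0)"
  shows "((\<lambda>h. f (p + h *\<^sub>R u)) has_vector_derivative d) (at 0)"
proof (rule has_vector_derivative_transform_within_open[OF assms(4)])
  show "open ((\<lambda>h. p + h *\<^sub>R u) -` S)"
    by (intro continuous_open_vimage continuous_intros \<open>open S\<close>)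
qed (use assms in auto)

lemma partial_deriv_eqI:
  "((\<lambda>h. f (p + h *\<^sub>R u)) has_vector_derivative d) (at 0) \<Longrightarrow> partial_deriv u f p = d"
  unfolding partial_deriv_def by (rule vector_derivative_at)

lemma x_dirs_in_C_m_2_dirs: "length is \<le> m \<Longrightarrow> map x_dir is \<in> C_m_2_dirs m"
  and t_dirs_in_C_m_2_dirs: "j \<le> 2 \<Longrightarrow> replicate j t_dir \<in> C_m_2_dirs m"
  by (auto simp: C_m_2_dirs_def)

lemma C_m_2_on_closure_extends:
  "C_m_2_on_closure m D f \<Longrightarrow> us \<in> C_m_2_dirs m \<Longrightarrow> extends_to_closure D (partial_derivs us f)"
  by (auto simp: C_m_2_on_closure_def extends_to_closure_def)

lemma C_m_2_on_closure_differentiable: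
  assumes "C_m_2_on_closure m D f" and "u # us \<in> C_m_2_dirs m" and "p \<in> D"
  shows "(\<lambda>h. partial_derivs us f (p + h *\<^sub>R u)) differentiable (at 0)"
proof -
  have "partial_derivs_exist D (u # us) f"
    using assms unfolding C_m_2_on_closure_def C_m_2_on_def by blast
  then show ?thesis using assms by simp
qed

lemma C_m_2_on_closure_t_derivs:
  fixes v :: "(real ^ 'n) \<times> real \<Rightarrow> 'b::real_normed_vector"
  assumes v: "C_m_2_on_closure m S v"
  shows "extends_to_closure S v" and "extends_to_closure S (t_deriv v)"
    and "extends_to_closure S (t_deriv (t_deriv v))"
    and "\<And>q. q \<in> S \<Longrightarrow> (\<lambda>h. v (q + h *\<^sub>R t_dir)) differentiable (at 0)"
    and "\<And>q. q \<in> S \<Longrightarrow> (\<lambda>h. t_deriv v (q + h *\<^sub>R t_dir)) differentiable (at 0)"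
  using C_m_2_on_closure_extends[OF v t_dirs_in_C_m_2_dirs[of 0]]
    C_m_2_on_closure_extends[OF v t_dirs_in_C_m_2_dirs[of 1]]
    C_m_2_on_closure_extends[OF v t_dirs_in_C_m_2_dirs[of 2]]
    C_m_2_on_closure_differentiable[OF v, of t_dir "[]"]
    C_m_2_on_closure_differentiable[OF v, of t_dir "[t_dir]"]
    t_dirs_in_C_m_2_dirs[of 1 m] t_dirs_in_C_m_2_dirs[of 2 m]
  by (auto simp: numeral_2_eq_2)

locale backward_domain =
  fixes l :: real and \<Omega> :: "((real ^ 'n) \<times> real) set"
  assumes l_pos: "l > 0" and open_domain: "open \<Omega>" and in_upper: "\<Omega> \<subseteq> upper_half_space"
    and backward: "backward_time_connected \<Omega>"
begin

abbreviation D :: "((real ^ 'n) \<times> real) set" where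
  "D \<equiv> phi_image l \<Omega>"

lemma open_D: "open D"
  using open_phi_image l_pos open_domain in_upper backward by blast

lemmas starlike_D = time_starlike_phi_image[of l \<Omega>]

lemma time_pos: "p \<in> \<Omega> \<Longrightarrow> snd p > 0"
  using in_upper by (auto simp: upper_half_space_def)

lemma lift_in_D: "p \<in> \<Omega> \<Longrightarrow> (fst p, phi l (snd p)) \<in> D"
  using phi_pos[OF l_pos time_pos, of p] by (force simp: phi_image_def)

lemma mean_transform_continuous:
  fixes g :: "(real ^ 'n) \<times> real \<Rightarrow> 'b::euclidean_space"
  assumes "w absolutely_integrable_on {0<..<1}" and "extends_to_closure D g"
    and \<kappa>: "continuous_on {0<..} \<kappa>"
  shows "continuous_on \<Omega> (mean_transform l \<kappa> w g)"
proof -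
  obtain H where H: "continuous_on (closure D) H" "\<forall>p\<in>D. H p = segment_mean w g p"
    using segment_mean_extends[OF starlike_D assms(1,2)] by (auto simp: extends_to_closure_def)
  have "continuous_on \<Omega> (\<lambda>p. \<kappa> (snd p) *\<^sub>R H (fst p, phi l (snd p)))"
  proof (intro continuous_intros continuous_on_compose2[OF H(1)] continuous_on_compose2[OF \<kappa>])
    show "continuous_on \<Omega> (\<lambda>p. phi l (snd p))"
      unfolding phi_def using time_pos by (intro continuous_intros) fastforce+
    show "(\<lambda>p. (fst p, phi l (snd p))) ` \<Omega> \<subseteq> closure D"
      using lift_in_D closure_subset by blast
  qed (use time_pos in auto)
  then show ?thesis
    by (rule continuous_on_eq) (use H(2) lift_in_D in \<open>auto simp: mean_transform_def\<close>)
qed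

lemma mean_transform_has_x_derivative:
  fixes g :: "(real ^ 'n) \<times> real \<Rightarrow> 'b::euclidean_space"
  assumes w: "w absolutely_integrable_on {0<..<1}" and p: "p \<in> \<Omega>"
    and g: "extends_to_closure D g" "extends_to_closure D (partial_deriv (x_dir i) g)"
    and diff: "\<And>q. q \<in> D \<Longrightarrow> (\<lambda>h. g (q + h *\<^sub>R x_dir i)) differentiable (at 0)"
  shows "((\<lambda>h. mean_transform l \<kappa> w g (p + h *\<^sub>R x_dir i)) has_vector_derivative
           mean_transform l \<kappa> w (partial_deriv (x_dir i) g) p) (at 0)"
proof -
  define q where "q = (fst p, phi l (snd p))"
  have "((\<lambda>h. segment_mean w g (q + h *\<^sub>R x_dir i)) has_vector_derivative
      segment_mean (\<lambda>s. 1 * w s) (partial_deriv (x_dir i) g) q) (at 0)"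
    by (rule segment_mean_has_derivative[OF starlike_D open_D w _ _ g diff])
      (use lift_in_D[OF p] in \<open>auto simp: q_def scale_time_def x_dir_def\<close>)
  then have "((\<lambda>h. \<kappa> (snd p) *\<^sub>R segment_mean w g (q + h *\<^sub>R x_dir i)) has_vector_derivative
      \<kappa> (snd p) *\<^sub>R segment_mean w (partial_deriv (x_dir i) g) q) (at 0)"
    by (intro derivative_eq_intros) auto
  then show ?thesis
    by (simp add: mean_transform_def q_def x_dir_def)
qed

text \<open>The chain rule with \<open>\<phi>'(t) = t powr (l / 2)\<close>: the first term differentiates the factor \<open>\<kappa>\<close>,
  the second one the mean.\<close>
lemma mean_transform_has_t_derivative:
  fixes g :: "(real ^ 'n) \<times> real \<Rightarrow> 'b::euclidean_space"
  assumes w: "w absolutely_integrable_on {0<..<1}" and p: "p \<in> \<Omega>"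
    and g: "extends_to_closure D g" "extends_to_closure D (t_deriv g)"
    and diff: "\<And>q. q \<in> D \<Longrightarrow> (\<lambda>h. g (q + h *\<^sub>R t_dir)) differentiable (at 0)"
    and \<kappa>: "(\<kappa> has_real_derivative \<kappa>' (snd p)) (at (snd p))"
  shows "((\<lambda>h. mean_transform l \<kappa> w g (p + h *\<^sub>R t_dir)) has_vector_derivative
           mean_transform l \<kappa>' w g p +
           mean_transform l (\<lambda>t. \<kappa> t * t powr (l / 2)) (\<lambda>s. s * w s) (t_deriv g) p) (at 0)"
proof -
  define t where "t = snd p"
  define q where "q = (fst p, phi l t)"
  have t: "t > 0" using time_pos[OF p] by (simp add: t_def)
  have "((\<lambda>h. segment_mean w g (q + h *\<^sub>R t_dir)) has_vector_derivative
      segment_mean (\<lambda>s. s * w s) (t_deriv g) q) (at (phi l (t + 0) - phi l t))"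
    using segment_mean_has_derivative[OF starlike_D open_D w _ _ g diff, where c = "\<lambda>s. s" and p = q]
      lift_in_D[OF p] by (auto simp: q_def t_def scale_time_def t_dir_def)
  moreover have "((\<lambda>h. phi l (t + h) - phi l t) has_vector_derivative t powr (l / 2)) (at 0)"
    using has_real_derivative_phi[OF l_pos t] DERIV_shift[of "phi l" "t powr (l / 2)" 0 t]
    by (auto intro!: derivative_eq_intros simp: add.commute
        simp flip: has_real_derivative_iff_has_vector_derivative)
  ultimately have "((\<lambda>h. segment_mean w g (q + h *\<^sub>R t_dir)) \<circ> (\<lambda>h. phi l (t + h) - phi l t)
      has_vector_derivative t powr (l / 2) *\<^sub>R segment_mean (\<lambda>s. s * w s) (t_deriv g) q) (at 0)"
    by (rule vector_diff_chain_at[rotated])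
  moreover have "(\<lambda>h. segment_mean w g (q + h *\<^sub>R t_dir)) \<circ> (\<lambda>h. phi l (t + h) - phi l t) =
      (\<lambda>h. segment_mean w g (fst p, phi l (t + h)))"
    by (simp add: q_def t_dir_def fun_eq_iff)
  ultimately have "((\<lambda>h. segment_mean w g (fst p, phi l (t + h))) has_vector_derivative
      t powr (l / 2) *\<^sub>R segment_mean (\<lambda>s. s * w s) (t_deriv g) q) (at 0)"
    by simp
  moreover have "((\<lambda>h. \<kappa> (t + h)) has_real_derivative \<kappa>' t) (at 0)"
    using \<kappa> DERIV_shift[of \<kappa> "\<kappa>' t" 0 t] by (simp add: t_def add.commute)
  ultimately have "((\<lambda>h. \<kappa> (t + h) *\<^sub>R segment_mean w g (fst p, phi l (t + h))) has_vector_derivative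
      \<kappa> (t + 0) *\<^sub>R (t powr (l / 2) *\<^sub>R segment_mean (\<lambda>s. s * w s) (t_deriv g) q) +
      \<kappa>' t *\<^sub>R segment_mean w g (fst p, phi l (t + 0))) (at 0)"
    by (intro has_vector_derivative_scaleR)
  then show ?thesis
    by (simp add: mean_transform_def q_def t_def t_dir_def add.commute)
qed

lemma mean_transform_x_derivs:
  fixes v :: "(real ^ 'n) \<times> real \<Rightarrow> 'b::euclidean_space"
  assumes w: "w absolutely_integrable_on {0<..<1}" and v: "C_m_2_on_closure m D v"
    and "length is \<le> m"
  shows "partial_derivs_exist \<Omega> (map x_dir is) (mean_transform l \<kappa> w v) \<and>
    (\<forall>p\<in>\<Omega>. partial_derivs (map x_dir is) (mean_transform l \<kappa> w v) p =
      mean_transform l \<kappa> w (partial_derivs (map x_dir is) v) p)"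
  using \<open>length is \<le> m\<close>
proof (induction "is")
  case (Cons i "is")
  let ?g = "partial_derivs (map x_dir is) v"
  have dirs: "x_dir i # map x_dir is \<in> C_m_2_dirs m" "map x_dir is \<in> C_m_2_dirs m"
    using x_dirs_in_C_m_2_dirs[of "i # is" m] x_dirs_in_C_m_2_dirs[of "is" m] Cons.prems by auto
  have IH: "partial_derivs_exist \<Omega> (map x_dir is) (mean_transform l \<kappa> w v)"
      "\<And>p. p \<in> \<Omega> \<Longrightarrow> partial_derivs (map x_dir is) (mean_transform l \<kappa> w v) p = mean_transform l \<kappa> w ?g p"
    using Cons by auto
  have mean_der: "((\<lambda>h. mean_transform l \<kappa> w ?g (p + h *\<^sub>R x_dir i)) has_vector_derivative
      mean_transform l \<kappa> w (partial_deriv (x_dir i) ?g) p) (at 0)" if "p \<in> \<Omega>" for p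
  proof (rule mean_transform_has_x_derivative[OF w that])
    show "extends_to_closure D ?g"
      by (rule C_m_2_on_closure_extends[OF v dirs(2)])
    show "extends_to_closure D (partial_deriv (x_dir i) ?g)"
      using C_m_2_on_closure_extends[OF v dirs(1)] by simp
    show "(\<lambda>h. ?g (q + h *\<^sub>R x_dir i)) differentiable (at 0)" if "q \<in> D" for q
      by (rule C_m_2_on_closure_differentiable[OF v dirs(1) that])
  qed
  have der: "((\<lambda>h. partial_derivs (map x_dir is) (mean_transform l \<kappa> w v) (p + h *\<^sub>R x_dir i))
      has_vector_derivative mean_transform l \<kappa> w (partial_deriv (x_dir i) ?g) p) (at 0)"
    if "p \<in> \<Omega>" for p
    by (rule has_vector_derivative_line_cong[OF open_domain that IH(2) mean_der[OF that]])
  then show ?case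
    using IH(1) partial_deriv_eqI[OF der] by (auto intro: differentiableI_vector)
qed simp

text \<open>An affine \<open>\<kappa>\<close> covers both transforms.  Since \<open>\<kappa>'' = 0\<close>, no term with \<open>v\<close> itself is left
  in the second derivative; what remains is \<open>(2\<kappa>'\<phi>' + \<kappa>\<phi>'')\<close> times a mean of the first and
  \<open>\<kappa>\<phi>'\<^sup>2\<close> times a mean of the second time derivative of \<open>v\<close>.\<close>
lemma mean_transform_t_derivs:
  fixes v :: "(real ^ 'n) \<times> real \<Rightarrow> 'b::euclidean_space"
  assumes w: "w absolutely_integrable_on {0<..<1}" and v: "C_m_2_on_closure m D v"
    and \<kappa>: "\<And>t. \<kappa> t = \<alpha> + \<beta> * t"
    and p: "p \<in> \<Omega>"
  shows mean_transform_t_derivative: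
    "((\<lambda>h. mean_transform l \<kappa> w v (p + h *\<^sub>R t_dir)) has_vector_derivative
      mean_transform l (\<lambda>t. \<beta>) w v p +
      mean_transform l (\<lambda>t. \<kappa> t * t powr (l / 2)) (\<lambda>s. s * w s) (t_deriv v) p) (at 0)"
    and mean_transform_tt_derivative:
    "((\<lambda>h. t_deriv (mean_transform l \<kappa> w v) (p + h *\<^sub>R t_dir)) has_vector_derivative
      mean_transform l (\<lambda>t. 2 * \<beta> * t powr (l / 2) + \<kappa> t * (l / 2 * t powr (l / 2 - 1)))
        (\<lambda>s. s * w s) (t_deriv v) p +
      mean_transform l (\<lambda>t. \<kappa> t * t powr l) (\<lambda>s. s * (s * w s)) (t_deriv (t_deriv v)) p) (at 0)"
proof -
  note ext = C_m_2_on_closure_t_derivs(1-3)[OF v] and diff = C_m_2_on_closure_t_derivs(4,5)[OF v]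
  have \<kappa>_der: "(\<kappa> has_real_derivative \<beta>) (at t)" for t
    unfolding \<kappa>[abs_def] by (auto intro!: derivative_eq_intros)
  have first: "((\<lambda>h. mean_transform l \<kappa> w v (q + h *\<^sub>R t_dir)) has_vector_derivative
      mean_transform l (\<lambda>t. \<beta>) w v q +
      mean_transform l (\<lambda>t. \<kappa> t * t powr (l / 2)) (\<lambda>s. s * w s) (t_deriv v) q) (at 0)"
    if "q \<in> \<Omega>" for q
    by (rule mean_transform_has_t_derivative[OF w that ext(1,2) diff(1) \<kappa>_der])
  from first[OF p] show "((\<lambda>h. mean_transform l \<kappa> w v (p + h *\<^sub>R t_dir)) has_vector_derivative
      mean_transform l (\<lambda>t. \<beta>) w v p +
      mean_transform l (\<lambda>t. \<kappa> t * t powr (l / 2)) (\<lambda>s. s * w s) (t_deriv v) p) (at 0)" .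
  have t: "snd p > 0" by (rule time_pos[OF p])
  let ?\<kappa>' = "\<lambda>t. \<beta> * t powr (l / 2) + \<kappa> t * (l / 2 * t powr (l / 2 - 1))"
  have "((\<lambda>h. mean_transform l (\<lambda>t. \<beta>) w v (p + h *\<^sub>R t_dir)) has_vector_derivative
      mean_transform l (\<lambda>t. 0) w v p +
      mean_transform l (\<lambda>t. \<beta> * t powr (l / 2)) (\<lambda>s. s * w s) (t_deriv v) p) (at 0)"
    by (rule mean_transform_has_t_derivative[OF w p ext(1,2) diff(1)]) auto
  moreover have "((\<lambda>h. mean_transform l (\<lambda>t. \<kappa> t * t powr (l / 2)) (\<lambda>s. s * w s) (t_deriv v) (p + h *\<^sub>R t_dir))
      has_vector_derivative mean_transform l ?\<kappa>' (\<lambda>s. s * w s) (t_deriv v) p +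
      mean_transform l (\<lambda>t. (\<kappa> t * t powr (l / 2)) * t powr (l / 2)) (\<lambda>s. s * (s * w s)) (t_deriv (t_deriv v)) p) (at 0)"
  proof (rule mean_transform_has_t_derivative[OF absolutely_integrable_times_variable[OF w] p ext(2,3) diff(2)])
    have "((\<lambda>t. \<kappa> t * t powr (l / 2)) has_real_derivative
        \<beta> * snd p powr (l / 2) + (l / 2 * snd p powr (l / 2 - 1)) * \<kappa> (snd p)) (at (snd p))"
      by (intro DERIV_mult \<kappa>_der has_real_derivative_powr t)
    then show "((\<lambda>t. \<kappa> t * t powr (l / 2)) has_real_derivative ?\<kappa>' (snd p)) (at (snd p))"
      by (simp only: mult.commute)
  qed
  ultimately have "((\<lambda>h. mean_transform l (\<lambda>t. \<beta>) w v (p + h *\<^sub>R t_dir) +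
        mean_transform l (\<lambda>t. \<kappa> t * t powr (l / 2)) (\<lambda>s. s * w s) (t_deriv v) (p + h *\<^sub>R t_dir))
      has_vector_derivative
      (mean_transform l (\<lambda>t. 0) w v p +
        mean_transform l (\<lambda>t. \<beta> * t powr (l / 2)) (\<lambda>s. s * w s) (t_deriv v) p) +
      (mean_transform l ?\<kappa>' (\<lambda>s. s * w s) (t_deriv v) p +
        mean_transform l (\<lambda>t. (\<kappa> t * t powr (l / 2)) * t powr (l / 2)) (\<lambda>s. s * (s * w s))
          (t_deriv (t_deriv v)) p)) (at 0)"
    by (rule has_vector_derivative_add)
  moreover have "snd p powr (l / 2) * snd p powr (l / 2) = snd p powr l"
    by (simp flip: powr_add)
  ultimately have "((\<lambda>h. mean_transform l (\<lambda>t. \<beta>) w v (p + h *\<^sub>R t_dir) +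
        mean_transform l (\<lambda>t. \<kappa> t * t powr (l / 2)) (\<lambda>s. s * w s) (t_deriv v) (p + h *\<^sub>R t_dir))
      has_vector_derivative
      mean_transform l (\<lambda>t. 2 * \<beta> * t powr (l / 2) + \<kappa> t * (l / 2 * t powr (l / 2 - 1)))
        (\<lambda>s. s * w s) (t_deriv v) p +
      mean_transform l (\<lambda>t. \<kappa> t * t powr l) (\<lambda>s. s * (s * w s)) (t_deriv (t_deriv v)) p) (at 0)"
    by (simp add: mean_transform_def mult.assoc flip: scaleR_add_left add.assoc)
  then show "((\<lambda>h. t_deriv (mean_transform l \<kappa> w v) (p + h *\<^sub>R t_dir)) has_vector_derivative
      mean_transform l (\<lambda>t. 2 * \<beta> * t powr (l / 2) + \<kappa> t * (l / 2 * t powr (l / 2 - 1)))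
        (\<lambda>s. s * w s) (t_deriv v) p +
      mean_transform l (\<lambda>t. \<kappa> t * t powr l) (\<lambda>s. s * (s * w s)) (t_deriv (t_deriv v)) p) (at 0)"
    by (rule has_vector_derivative_line_cong[OF open_domain p, rotated])
      (rule partial_deriv_eqI[OF first])
qed

lemma mean_transform_C_m_2:
  fixes v :: "(real ^ 'n) \<times> real \<Rightarrow> 'b::euclidean_space"
  assumes w: "w absolutely_integrable_on {0<..<1}" and v: "C_m_2_on_closure m D v"
    and \<kappa>: "\<And>t. \<kappa> t = \<alpha> + \<beta> * t"
  shows "C_m_2_on m \<Omega> (mean_transform l \<kappa> w v)"
proof -
  let ?U = "mean_transform l \<kappa> w v"
  note first = mean_transform_t_derivative[OF w v \<kappa>]
  note second = mean_transform_tt_derivative[OF w v \<kappa>]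
  have \<kappa>_cont: "continuous_on {0<..} \<kappa>"
    unfolding \<kappa>[abs_def] by (intro continuous_intros)
  have x: "partial_derivs_exist \<Omega> (map x_dir is) ?U \<and> continuous_on \<Omega> (partial_derivs (map x_dir is) ?U)"
    if "length is \<le> m" for "is"
  proof -
    have "continuous_on \<Omega> (mean_transform l \<kappa> w (partial_derivs (map x_dir is) v))"
      by (intro mean_transform_continuous w \<kappa>_cont C_m_2_on_closure_extends[OF v]
          x_dirs_in_C_m_2_dirs that)
    then show ?thesis
      using mean_transform_x_derivs[OF w v that, of \<kappa>] by (auto cong: continuous_on_cong)
  qed
  note ext = C_m_2_on_closure_t_derivs(1-3)[OF v]
  have "continuous_on \<Omega> (t_deriv ?U)"
  proof (rule continuous_on_eq)
    show "continuous_on \<Omega> (\<lambda>p. mean_transform l (\<lambda>t. \<beta>) w v p +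
        mean_transform l (\<lambda>t. \<kappa> t * t powr (l / 2)) (\<lambda>s. s * w s) (t_deriv v) p)"
      by (intro continuous_on_add mean_transform_continuous w ext absolutely_integrable_times_variable
          continuous_intros \<kappa>_cont) auto
  qed (rule partial_deriv_eqI[OF first, symmetric])
  moreover have "continuous_on \<Omega> (t_deriv (t_deriv ?U))"
  proof (rule continuous_on_eq)
    show "continuous_on \<Omega> (\<lambda>p.
        mean_transform l (\<lambda>t. 2 * \<beta> * t powr (l / 2) + \<kappa> t * (l / 2 * t powr (l / 2 - 1)))
          (\<lambda>s. s * w s) (t_deriv v) p +
        mean_transform l (\<lambda>t. \<kappa> t * t powr l) (\<lambda>s. s * (s * w s)) (t_deriv (t_deriv v)) p)"
      by (intro continuous_on_add mean_transform_continuous w ext absolutely_integrable_times_variable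
          continuous_intros \<kappa>_cont) auto
  qed (rule partial_deriv_eqI[OF second, symmetric])
  moreover have "continuous_on \<Omega> ?U"
    by (intro mean_transform_continuous w ext \<kappa>_cont)
  moreover have "(\<lambda>h. ?U (p + h *\<^sub>R t_dir)) differentiable (at 0)"
    "(\<lambda>h. t_deriv ?U (p + h *\<^sub>R t_dir)) differentiable (at 0)" if "p \<in> \<Omega>" for p
    using first[OF that] second[OF that] by (auto intro: differentiableI_vector)
  ultimately have "partial_derivs_exist \<Omega> (replicate j t_dir) ?U \<and>
      continuous_on \<Omega> (partial_derivs (replicate j t_dir) ?U)" if "j \<le> 2" for j
    using that by (auto simp: numeral_2_eq_2 le_Suc_eq)
  with x show ?thesis
    by (auto simp: C_m_2_on_def C_m_2_dirs_def)
qed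

end

section \<open>The equation and the initial values\<close>

lemma finite_multi_indices: "finite (multi_indices m :: ('n::finite \<Rightarrow> nat) set)"
proof (rule finite_subset)
  show "multi_indices m \<subseteq> (UNIV::'n set) \<rightarrow>\<^sub>E {..m}"
  proof
    fix \<alpha> :: "'n \<Rightarrow> nat" assume "\<alpha> \<in> multi_indices m"
    then have "\<alpha> i \<le> m" for i
      using member_le_sum[of i UNIV \<alpha>] by (simp add: multi_indices_def)
    then show "\<alpha> \<in> UNIV \<rightarrow>\<^sub>E {..m}" by auto
  qed
qed (auto intro: finite_PiE)

text \<open>This links the multi-index notation of the operator with the lists of directions, for which the
  space derivatives of the transforms have been computed.\<close>
lemma multi_index_directions:
  fixes \<alpha> :: "'n::finite \<Rightarrow> nat"
  assumes "\<alpha> \<in> multi_indices m"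
  obtains "is" :: "'n list" where "length is \<le> m"
    and "concat (map (\<lambda>i. replicate (\<alpha> i) (x_dir i)) coordinates) = map x_dir is"
proof -
  have "\<exists>is :: 'n list. distinct is \<and> set is = UNIV"
    using finite_distinct_list[of "UNIV :: 'n set"] by auto
  then have coords: "distinct (coordinates :: 'n list)" "set (coordinates :: 'n list) = UNIV"
    unfolding coordinates_def by (metis (mono_tags, lifting) someI_ex)+
  let ?is = "concat (map (\<lambda>i. replicate (\<alpha> i) i) coordinates)"
  have "length ?is = (\<Sum>i\<in>UNIV. \<alpha> i)"
    using coords by (simp add: length_concat o_def sum_list_distinct_conv_sum_set)
  then have "length ?is \<le> m"
    using assms by (simp add: multi_indices_def)
  moreover have "concat (map (\<lambda>i. replicate (\<alpha> i) (x_dir i)) coordinates) = map x_dir ?is"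
    by (simp add: map_concat o_def)
  ultimately show ?thesis using that by blast
qed

text \<open>The assumption \<open>p \<notin> D\<close> makes \<open>p\<close> a limit point of \<open>D\<close>, which is needed for the limit to be
  determined.\<close>
lemma extended_value_eq:
  assumes "continuous_on (closure D) G" and "\<And>q. q \<in> D \<Longrightarrow> G q = f q"
    and "p \<in> closure D" and "p \<notin> D"
  shows "extended_value D f p = G p"
proof -
  have "(G \<longlongrightarrow> G p) (at p within D)"
    using assms(1,3) closure_subset tendsto_within_subset by (metis continuous_on_def)
  then have "(f \<longlongrightarrow> G p) (at p within D)"
    by (rule Lim_transform_eventually) (use assms(2) in \<open>auto simp: eventually_at_filter\<close>)
  moreover have "at p within D \<noteq> bot"
    using assms(3,4) by (simp add: trivial_limit_within closure_def)
  ultimately show ?thesis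
    unfolding extended_value_def using tendsto_Lim by blast
qed

context backward_domain
begin

text \<open>The coefficients of the operator do not depend on time, hence are constant along the segment
  over which the mean is taken.\<close>
lemma diff_op_mean_transform:
  fixes v :: "(real ^ 'n) \<times> real \<Rightarrow> 'b::{real_normed_field, euclidean_space}"
  assumes w: "w absolutely_integrable_on {0<..<1}" and v: "C_m_2_on_closure m D v"
    and p: "p \<in> \<Omega>"
  shows "diff_op m a (mean_transform l \<kappa> w v) p = mean_transform l \<kappa> w (diff_op m a v) p"
proof -
  let ?q = "(fst p, phi l (snd p))"
  have term_eq: "multi_deriv \<alpha> (mean_transform l \<kappa> w v) p = mean_transform l \<kappa> w (multi_deriv \<alpha> v) p"
    and ext: "extends_to_closure D (multi_deriv \<alpha> v)" if \<alpha>: "\<alpha> \<in> multi_indices m" for \<alpha>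
  proof -
    obtain "is" where "is": "length is \<le> m"
      and dirs: "concat (map (\<lambda>i. replicate (\<alpha> i) (x_dir i)) coordinates) = map x_dir is"
      by (rule multi_index_directions[OF \<alpha>])
    have "\<forall>p\<in>\<Omega>. partial_derivs (map x_dir is) (mean_transform l \<kappa> w v) p =
        mean_transform l \<kappa> w (partial_derivs (map x_dir is) v) p"
      using mean_transform_x_derivs[OF w v "is"] by blast
    then show "multi_deriv \<alpha> (mean_transform l \<kappa> w v) p = mean_transform l \<kappa> w (multi_deriv \<alpha> v) p"
      unfolding multi_deriv_def dirs using p by blast
    show "extends_to_closure D (multi_deriv \<alpha> v)"
      unfolding multi_deriv_def dirs
      by (rule C_m_2_on_closure_extends[OF v x_dirs_in_C_m_2_dirs[OF "is"]])
  qed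
  have int: "(\<lambda>s. w s *\<^sub>R multi_deriv \<alpha> v (scale_time s ?q)) integrable_on {0<..<1}"
    if "\<alpha> \<in> multi_indices m" for \<alpha>
    by (rule segment_integrand_integrable[OF starlike_D w ext[OF that] lift_in_D[OF p]])
  have "integral {0<..<1} (\<lambda>s. w s *\<^sub>R diff_op m a v (scale_time s ?q)) =
      integral {0<..<1} (\<lambda>s. \<Sum>\<alpha>\<in>multi_indices m. a \<alpha> (fst p) * (w s *\<^sub>R multi_deriv \<alpha> v (scale_time s ?q)))"
    by (simp add: diff_op_def scaleR_sum_right scale_time_def)
  also have "\<dots> = (\<Sum>\<alpha>\<in>multi_indices m.
      integral {0<..<1} (\<lambda>s. a \<alpha> (fst p) * (w s *\<^sub>R multi_deriv \<alpha> v (scale_time s ?q))))"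
    by (intro integral_sum finite_multi_indices integrable_on_mult_right int)
  also have "\<dots> = (\<Sum>\<alpha>\<in>multi_indices m. a \<alpha> (fst p) * segment_mean w (multi_deriv \<alpha> v) ?q)"
    unfolding segment_mean_def by (intro sum.cong refl integral_mult_right int)
  finally have "segment_mean w (diff_op m a v) ?q =
      (\<Sum>\<alpha>\<in>multi_indices m. a \<alpha> (fst p) * segment_mean w (multi_deriv \<alpha> v) ?q)"
    by (simp add: segment_mean_def)
  then show ?thesis
    by (simp add: diff_op_def term_eq mean_transform_def scaleR_sum_right)
qed

lemma boundary_point:
  assumes "(x0, t0) \<in> \<Omega>"
  shows "(x0, 0) \<in> closure D" and "(x0, 0) \<notin> D"
proof -
  have "scale_time 0 (x0, phi l t0) \<in> closure D"
    using lift_in_D[OF assms] closure_subset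
    by (intro scale_time_closure[OF starlike_D]) auto
  then show "(x0, 0) \<in> closure D" by (simp add: scale_time_def)
qed (auto simp: phi_image_def)

text \<open>In the residual the operator applied to \<open>v\<close> is replaced by the second time derivative of \<open>v\<close>.
  Since \<open>\<phi>'\<^sup>2 = t powr l\<close>, the two means of that derivative differ by the weight factor \<open>1 - s\<^sup>2\<close>,
  which raises the exponent of the weight to \<open>\<mu>\<close> and allows an integration by parts.  The result
  is a boundary value and a multiple of the mean of the first derivative; the condition
  \<open>exponent\<close> says that this multiple cancels the first-order term of the second time derivative.
  Its nonzero solutions are constant \<open>\<kappa>\<close> with \<open>\<mu> = \<gamma>\<close> and linear \<open>\<kappa>\<close> with \<open>\<mu> = 1 - \<gamma>\<close>, which explains
  the exponents and factors in \<open>K0\<close> and \<open>K1\<close>.\<close>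
lemma mean_transform_equation:
  fixes v :: "(real ^ 'n) \<times> real \<Rightarrow> 'b::{real_normed_field, euclidean_space}"
  assumes "\<mu> > 0" and v: "C_m_2_on_closure m D v" and \<kappa>: "\<And>t. \<kappa> t = \<alpha> + \<beta> * t"
    and exponent: "\<And>t. 2 * \<beta> * t + \<kappa> t * (l / 2) = \<mu> * (l + 2) * \<kappa> t"
    and t0: "(x0, t0) \<in> \<Omega>" and t: "t \<in> {0<..<t0}"
    and wave: "\<forall>t\<in>{0<..<phi l t0}. t_deriv (t_deriv v) (x0, t) - diff_op m a v (x0, t) = 0"
  defines "U \<equiv> mean_transform l \<kappa> (\<lambda>s. (1 - s\<^sup>2) powr (\<mu> - 1)) v"
  shows "t_deriv (t_deriv U) (x0, t) - t powr l *\<^sub>R diff_op m a U (x0, t) =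
    (\<kappa> t * ((l + 2) / 2) * t powr (l / 2 - 1)) *\<^sub>R extended_value D (t_deriv v) (x0, 0)"
proof -
  define w where "w s = (1 - s\<^sup>2) powr (\<mu> - 1)" for s :: real
  define q where "q = (x0, phi l t)"
  have w: "w absolutely_integrable_on {0<..<1}"
    unfolding w_def[abs_def] by (rule one_minus_square_powr_absolutely_integrable[OF \<open>\<mu> > 0\<close>])
  have p: "(x0, t) \<in> \<Omega>"
    using backward t0 t by (fastforce simp: backward_time_connected_def)
  have tpos: "t > 0" using t by simp
  have q: "q \<in> D" using lift_in_D[OF p] by (simp add: q_def)
  note ext = C_m_2_on_closure_t_derivs(2,3)[OF v] and diff = C_m_2_on_closure_t_derivs(5)[OF v]
  obtain G where G: "continuous_on (closure D) G" "\<And>q. q \<in> D \<Longrightarrow> G q = t_deriv v q"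
    using ext(1) by (auto simp: extends_to_closure_def)
  let ?M1 = "segment_mean (\<lambda>s. s * w s) (t_deriv v) q"
  let ?M2 = "\<lambda>w. segment_mean w (t_deriv (t_deriv v)) q"
  have "diff_op m a U (x0, t) = mean_transform l \<kappa> w (diff_op m a v) (x0, t)"
    unfolding U_def w_def[symmetric] by (rule diff_op_mean_transform[OF w v p])
  also have "\<dots> = \<kappa> t *\<^sub>R ?M2 w"
  proof -
    have "segment_mean w (diff_op m a v) q = ?M2 w"
      unfolding segment_mean_def
    proof (rule integral_cong)
      fix s :: real assume s: "s \<in> {0<..<1}"
      have "0 < phi l t" using phi_pos l_pos tpos by blast
      moreover have "phi l t < phi l t0" using phi_less l_pos t by auto
      moreover have "phi l t * s \<le> phi l t" using s \<open>0 < phi l t\<close> by (simp add: mult_left_le)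
      ultimately have "0 < phi l t * s" "phi l t * s < phi l t0" using s by (simp, linarith)
      then show "w s *\<^sub>R diff_op m a v (scale_time s q) = w s *\<^sub>R t_deriv (t_deriv v) (scale_time s q)"
        using wave by (simp add: scale_time_def q_def)
    qed
    then show ?thesis by (simp add: mean_transform_def q_def)
  qed
  finally have AU: "diff_op m a U (x0, t) = \<kappa> t *\<^sub>R ?M2 w" .
  have Utt: "t_deriv (t_deriv U) (x0, t) =
      (2 * \<beta> * t powr (l / 2) + \<kappa> t * (l / 2 * t powr (l / 2 - 1))) *\<^sub>R ?M1 +
      (\<kappa> t * t powr l) *\<^sub>R ?M2 (\<lambda>s. s * (s * w s))"
  proof -
    have "t_deriv (t_deriv U) (x0, t) =
        mean_transform l (\<lambda>t. 2 * \<beta> * t powr (l / 2) + \<kappa> t * (l / 2 * t powr (l / 2 - 1)))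
          (\<lambda>s. s * w s) (t_deriv v) (x0, t) +
        mean_transform l (\<lambda>t. \<kappa> t * t powr l) (\<lambda>s. s * (s * w s)) (t_deriv (t_deriv v)) (x0, t)"
      unfolding U_def w_def[symmetric]
      by (rule partial_deriv_eqI[OF mean_transform_tt_derivative[OF w v \<kappa> p]])
    then show ?thesis by (simp add: mean_transform_def q_def)
  qed
  have split: "?M2 w - ?M2 (\<lambda>s. s * (s * w s)) = ?M2 (\<lambda>s. (1 - s\<^sup>2) powr \<mu>)"
  proof -
    have "?M2 w - ?M2 (\<lambda>s. s * (s * w s)) = integral {0<..<1}
        (\<lambda>s. w s *\<^sub>R t_deriv (t_deriv v) (scale_time s q) - (s * (s * w s)) *\<^sub>R t_deriv (t_deriv v) (scale_time s q))"
      unfolding segment_mean_def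
      by (intro integral_diff[symmetric] segment_integrand_integrable[OF starlike_D _ ext(2) q]
          absolutely_integrable_times_variable w)
    also have "\<dots> = ?M2 (\<lambda>s. (1 - s\<^sup>2) powr \<mu>)"
      unfolding segment_mean_def
    proof (rule integral_cong)
      fix s :: real assume s: "s \<in> {0<..<1}"
      then have "1 - s\<^sup>2 > 0" by (simp add: abs_square_less_1)
      then have "(1 - s\<^sup>2) powr \<mu> = (1 - s\<^sup>2) * w s"
        by (simp add: w_def powr_diff)
      also have "\<dots> = w s - s * (s * w s)"
        by (simp add: algebra_simps power2_eq_square)
      finally have "(1 - s\<^sup>2) powr \<mu> = w s - s * (s * w s)" .
      then show "w s *\<^sub>R t_deriv (t_deriv v) (scale_time s q) - (s * (s * w s)) *\<^sub>R t_deriv (t_deriv v) (scale_time s q)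
          = (1 - s\<^sup>2) powr \<mu> *\<^sub>R t_deriv (t_deriv v) (scale_time s q)"
        by (simp add: scaleR_diff_left)
    qed
    finally show ?thesis .
  qed
  have parts: "phi l t *\<^sub>R ?M2 (\<lambda>s. (1 - s\<^sup>2) powr \<mu>) = (2 * \<mu>) *\<^sub>R ?M1 - G (x0, 0)"
    using segment_mean_integration_by_parts[OF starlike_D \<open>\<mu> > 0\<close> q G ext(2) diff]
    by (simp add: q_def w_def)
  \<comment> \<open>\<open>c = t powr l / phi l t\<close>, the factor by which the integration by parts enters.\<close>
  define c where "c = (l + 2) / 2 * t powr (l / 2 - 1)"
  have "c * phi l t = t powr (l / 2 - 1 + (l + 2) / 2)"
    unfolding powr_add c_def phi_def using l_pos by (simp add: field_simps)
  then have c: "c * phi l t = t powr l"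
    by (simp add: add_divide_distrib)
  have t_half: "t powr (l / 2) = t * t powr (l / 2 - 1)"
    using tpos by (simp add: powr_diff)
  have "2 * \<beta> * t powr (l / 2) + \<kappa> t * (l / 2 * t powr (l / 2 - 1)) =
      (2 * \<beta> * t + \<kappa> t * (l / 2)) * t powr (l / 2 - 1)"
    by (simp add: t_half algebra_simps)
  also have "\<dots> = \<kappa> t * c * (2 * \<mu>)"
    unfolding exponent c_def by simp
  finally have coeff: "2 * \<beta> * t powr (l / 2) + \<kappa> t * (l / 2 * t powr (l / 2 - 1)) = \<kappa> t * c * (2 * \<mu>)" .
  have "t_deriv (t_deriv U) (x0, t) - t powr l *\<^sub>R diff_op m a U (x0, t) =
      (\<kappa> t * c * (2 * \<mu>)) *\<^sub>R ?M1 - (\<kappa> t * t powr l) *\<^sub>R (?M2 w - ?M2 (\<lambda>s. s * (s * w s)))"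
    unfolding Utt AU coeff by (simp add: algebra_simps)
  also have "\<dots> = (\<kappa> t * c) *\<^sub>R ((2 * \<mu>) *\<^sub>R ?M1 - phi l t *\<^sub>R ?M2 (\<lambda>s. (1 - s\<^sup>2) powr \<mu>))"
    unfolding split by (simp add: algebra_simps flip: c)
  also have "\<dots> = (\<kappa> t * c) *\<^sub>R G (x0, 0)"
    unfolding parts by simp
  also have "G (x0, 0) = extended_value D (t_deriv v) (x0, 0)"
    using extended_value_eq[OF G boundary_point[OF t0]] by simp
  finally show ?thesis
    by (simp add: c_def mult.assoc)
qed

lemma mean_transform_tendsto:
  fixes g :: "(real ^ 'n) \<times> real \<Rightarrow> 'b::euclidean_space"
  assumes w: "w absolutely_integrable_on {0<..<1}" and g: "extends_to_closure D g"
    and \<kappa>: "(\<kappa> \<longlongrightarrow> k) (at_right 0)" and t0: "(x0, t0) \<in> \<Omega>"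
  shows "(mean_transform l \<kappa> w g \<longlongrightarrow>
    (k * integral {0<..<1} w) *\<^sub>R extended_value D g (x0, 0)) (at (x0, 0) within \<Omega>)"
proof -
  let ?F = "at (x0, 0) within \<Omega>"
  note bd = boundary_point[OF t0]
  obtain G where G: "continuous_on (closure D) G" "\<And>q. q \<in> D \<Longrightarrow> G q = g q"
    using g by (auto simp: extends_to_closure_def)
  have in_\<Omega>: "eventually (\<lambda>p. p \<in> \<Omega>) ?F"
    by (simp add: eventually_at_filter)
  have fst: "(fst \<longlongrightarrow> x0) ?F" and snd: "(snd \<longlongrightarrow> 0) ?F"
    using tendsto_fst[OF tendsto_ident_at[of "(x0, 0::real)" \<Omega>]]
      tendsto_snd[OF tendsto_ident_at[of "(x0, 0::real)" \<Omega>]] by simp_all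
  have "filterlim snd (at_right 0) ?F"
    unfolding filterlim_at using snd in_\<Omega> by (auto elim!: eventually_mono dest: time_pos)
  then have \<kappa>_lim: "((\<lambda>p. \<kappa> (snd p)) \<longlongrightarrow> k) ?F"
    and phi_lim: "((\<lambda>p. phi l (snd p)) \<longlongrightarrow> 0) ?F"
    using filterlim_compose[OF \<kappa>] filterlim_compose[OF tendsto_phi_at_0[OF l_pos]] by auto
  have "((\<lambda>p. segment_mean w G (fst p, phi l (snd p))) \<longlongrightarrow> segment_mean w G (x0, 0)) ?F"
  proof (rule continuous_within_tendsto_compose[where f = "segment_mean w G" and S = "closure D"])
    show "continuous (at (x0, 0) within closure D) (segment_mean w G)"
      using continuous_on_segment_mean[OF starlike_D w G(1)] bd(1)
      by (simp add: continuous_on_eq_continuous_within)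
    show "eventually (\<lambda>p. (fst p, phi l (snd p)) \<in> closure D) ?F"
      using in_\<Omega> by (rule eventually_mono) (use lift_in_D closure_subset in blast)
  qed (intro tendsto_Pair fst phi_lim)
  then have "((\<lambda>p. \<kappa> (snd p) *\<^sub>R segment_mean w G (fst p, phi l (snd p))) \<longlongrightarrow>
      k *\<^sub>R segment_mean w G (x0, 0)) ?F"
    by (intro tendsto_scaleR \<kappa>_lim)
  moreover have "eventually (\<lambda>p. \<kappa> (snd p) *\<^sub>R segment_mean w G (fst p, phi l (snd p)) =
      mean_transform l \<kappa> w g p) ?F"
    using in_\<Omega>
    by (rule eventually_mono)
      (simp add: mean_transform_def segment_mean_cong[OF starlike_D lift_in_D, of _ G g] G(2))
  moreover have "segment_mean w G (x0, 0) = integral {0<..<1} w *\<^sub>R G (x0, 0)"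
  proof -
    have "(w has_integral integral {0<..<1} w) {0<..<1}"
      using w by (simp add: absolutely_integrable_on_def integrable_integral)
    then show ?thesis
      by (auto simp: segment_mean_def scale_time_def intro!: integral_unique has_integral_scaleR_left)
  qed
  ultimately show ?thesis
    using extended_value_eq[OF G bd] by (auto intro: Lim_transform_eventually)
qed

text \<open>For the time derivative, the term in which the mean has been differentiated carries the factor
  \<open>t powr (l / 2)\<close>, so that at time \<open>0\<close> only the derivative \<open>\<beta>\<close> of \<open>\<kappa>\<close> is seen.\<close>
lemma mean_transform_initial_values:
  fixes v :: "(real ^ 'n) \<times> real \<Rightarrow> 'b::euclidean_space"
  assumes w: "w absolutely_integrable_on {0<..<1}" and v: "C_m_2_on_closure m D v"
    and \<kappa>: "\<And>t. \<kappa> t = \<alpha> + \<beta> * t" and t0: "(x0, t0) \<in> \<Omega>"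
  shows "(mean_transform l \<kappa> w v \<longlongrightarrow>
      (\<alpha> * integral {0<..<1} w) *\<^sub>R extended_value D v (x0, 0)) (at (x0, 0) within \<Omega>)"
    and "(t_deriv (mean_transform l \<kappa> w v) \<longlongrightarrow>
      (\<beta> * integral {0<..<1} w) *\<^sub>R extended_value D v (x0, 0)) (at (x0, 0) within \<Omega>)"
proof -
  note ext = C_m_2_on_closure_t_derivs(1,2)[OF v]
  have \<kappa>_lim: "(\<kappa> \<longlongrightarrow> \<alpha>) (at_right 0)"
    unfolding \<kappa>[abs_def] by (auto intro!: tendsto_eq_intros)
  then show "(mean_transform l \<kappa> w v \<longlongrightarrow>
      (\<alpha> * integral {0<..<1} w) *\<^sub>R extended_value D v (x0, 0)) (at (x0, 0) within \<Omega>)"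
    by (rule mean_transform_tendsto[OF w ext(1) _ t0])
  have "((\<lambda>t. t powr (l / 2)) \<longlongrightarrow> 0) (at_right 0)"
    using l_pos by (auto intro!: tendsto_eq_intros eventually_at_rightI[of 0 1])
  then have "((\<lambda>t. \<kappa> t * t powr (l / 2)) \<longlongrightarrow> 0) (at_right 0)"
    using tendsto_mult[OF \<kappa>_lim] by fastforce
  then have "((\<lambda>p. mean_transform l (\<lambda>t. \<beta>) w v p +
      mean_transform l (\<lambda>t. \<kappa> t * t powr (l / 2)) (\<lambda>s. s * w s) (t_deriv v) p) \<longlongrightarrow>
      (\<beta> * integral {0<..<1} w) *\<^sub>R extended_value D v (x0, 0) +
      (0 * integral {0<..<1} (\<lambda>s. s * w s)) *\<^sub>R extended_value D (t_deriv v) (x0, 0))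
      (at (x0, 0) within \<Omega>)"
    by (intro tendsto_add mean_transform_tendsto[OF w ext(1) _ t0] tendsto_const
        mean_transform_tendsto[OF absolutely_integrable_times_variable[OF w] ext(2) _ t0])
  then show "(t_deriv (mean_transform l \<kappa> w v) \<longlongrightarrow>
      (\<beta> * integral {0<..<1} w) *\<^sub>R extended_value D v (x0, 0)) (at (x0, 0) within \<Omega>)"
    by (simp, elim Lim_transform_eventually)
      (auto simp: eventually_at_filter partial_deriv_eqI[OF mean_transform_t_derivative[OF w v \<kappa>]])
qed

end

theorem theorem1p6:
  fixes l t0 :: real
    and m :: nat
    and \<Omega> :: "((real ^ 'n) \<times> real) set"
    and x0 :: "real ^ 'n"
    and a :: "('n \<Rightarrow> nat) \<Rightarrow> real ^ 'n \<Rightarrow> 'b::{real_normed_field, euclidean_space}"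
    and v :: "(real ^ 'n) \<times> real \<Rightarrow> 'b"
  assumes "l > 0"
    and "open \<Omega>" and "connected \<Omega>" and "\<Omega> \<subseteq> upper_half_space"
    and "backward_time_connected \<Omega>"
    and "(x0, t0) \<in> \<Omega>"
    and "\<forall>\<alpha>\<in>multi_indices m. C_infinity_on (fst ` \<Omega>) (a \<alpha>)"
    and "C_m_2_on_closure m (phi_image l \<Omega>) v"
    and "\<forall>t\<in>{0<..<phi l t0}. t_deriv (t_deriv v) (x0, t) - diff_op m a v (x0, t) = 0"
  shows "C_m_2_on m \<Omega> (K0 l v) \<and> C_m_2_on m \<Omega> (K1 l v) \<and>
    (\<forall>t\<in>{0<..<t0}.
       t_deriv (t_deriv (K0 l v)) (x0, t) - t powr l *\<^sub>R diff_op m a (K0 l v) (x0, t) =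
       (a_const l * t powr (l / 2 - 1)) *\<^sub>R extended_value (phi_image l \<Omega>) (t_deriv v) (x0, 0)) \<and>
    (\<forall>t\<in>{0<..<t0}.
       t_deriv (t_deriv (K1 l v)) (x0, t) - t powr l *\<^sub>R diff_op m a (K1 l v) (x0, t) =
       (b_const l * t powr (l / 2)) *\<^sub>R extended_value (phi_image l \<Omega>) (t_deriv v) (x0, 0)) \<and>
    (K0 l v \<longlongrightarrow> extended_value (phi_image l \<Omega>) v (x0, 0)) (at (x0, 0) within \<Omega>) \<and>
    (t_deriv (K0 l v) \<longlongrightarrow> 0) (at (x0, 0) within \<Omega>) \<and>
    (K1 l v \<longlongrightarrow> 0) (at (x0, 0) within \<Omega>) \<and>
    (t_deriv (K1 l v) \<longlongrightarrow> extended_value (phi_image l \<Omega>) v (x0, 0)) (at (x0, 0) within \<Omega>)"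
proof -
  interpret backward_domain l \<Omega>
    by unfold_locales (use assms in auto)
  note v = assms(8)
  let ?\<gamma> = "gam l"
  define c0 where "c0 = 2 powr (2 - 2 * ?\<gamma>) * Gamma (2 * ?\<gamma>) / (Gamma ?\<gamma>)\<^sup>2"
  define c1 where "c1 = 2 powr (2 * ?\<gamma>) * Gamma (2 - 2 * ?\<gamma>) / (Gamma (1 - ?\<gamma>))\<^sup>2"
  define w where "w \<mu> s = (1 - s\<^sup>2) powr (\<mu> - 1)" for \<mu> s :: real
  have \<gamma>: "0 < ?\<gamma>" "?\<gamma> < 1 / 2"
    using \<open>l > 0\<close> by (auto simp: gam_def field_simps)
  have \<gamma>_l: "?\<gamma> * (l + 2) = l / 2"
    using \<open>l > 0\<close> by (simp add: gam_def field_simps)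
  have w: "w \<mu> absolutely_integrable_on {0<..<1}" if "\<mu> > 0" for \<mu>
    unfolding w_def[abs_def] by (rule one_minus_square_powr_absolutely_integrable[OF that])
  have moment: "integral {0<..<1} (w \<mu>) = 2 powr (2 * \<mu> - 2) * (Gamma \<mu>)\<^sup>2 / Gamma (2 * \<mu>)"
    if "\<mu> > 0" for \<mu>
    using has_integral_one_minus_square_powr[OF that] by (simp add: w_def[abs_def] integral_unique)
  have K0: "K0 l v = mean_transform l (\<lambda>t. c0) (w ?\<gamma>) v"
    by (auto simp: fun_eq_iff K0_def mean_transform_def c0_def segment_mean_def w_def scale_time_def
        integral_open_interval_real)
  have K1: "K1 l v = mean_transform l (\<lambda>t. c1 * t) (w (1 - ?\<gamma>)) v"
    by (auto simp: fun_eq_iff K1_def mean_transform_def c1_def segment_mean_def w_def scale_time_def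
        integral_open_interval_real)
  have c0: "c0 * integral {0<..<1} (w ?\<gamma>) = 1"
  proof -
    have "Gamma ?\<gamma> \<noteq> 0" "Gamma (2 * ?\<gamma>) \<noteq> 0"
      using \<gamma> by (auto intro!: less_imp_neq[THEN not_sym] Gamma_real_pos)
    moreover have "(2::real) powr (2 - 2 * ?\<gamma>) * 2 powr (2 * ?\<gamma> - 2) = 1"
      by (simp flip: powr_add)
    ultimately show ?thesis
      by (simp add: c0_def moment[OF \<gamma>(1)] field_simps)
  qed
  have c1: "c1 * integral {0<..<1} (w (1 - ?\<gamma>)) = 1"
  proof -
    have "Gamma (1 - ?\<gamma>) \<noteq> 0" "Gamma (2 - 2 * ?\<gamma>) \<noteq> 0"
      using \<gamma> by (auto intro!: less_imp_neq[THEN not_sym] Gamma_real_pos)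
    moreover have "(2::real) powr (2 * ?\<gamma>) * 2 powr (2 * (1 - ?\<gamma>) - 2) = 1"
      by (simp flip: powr_add)
    moreover have "2 * (1 - ?\<gamma>) = 2 - 2 * ?\<gamma>" by simp
    ultimately show ?thesis
      using \<gamma> by (simp add: c1_def moment field_simps)
  qed
  have a_const: "c0 * ((l + 2) / 2) = a_const l"
  proof -
    have "(2::real) powr (2 - 2 * ?\<gamma>) = 2 * 2 powr (1 - 2 * ?\<gamma>)"
      using powr_add[of 2 1 "1 - 2 * ?\<gamma>"] by simp
    moreover have "l / (2 * ?\<gamma>) = l + 2"
      using \<gamma> \<gamma>_l by (simp add: field_simps)
    moreover have "a_const l = 2 powr (1 - 2 * ?\<gamma>) * (l / (2 * ?\<gamma>)) * Gamma (2 * ?\<gamma>) / (Gamma ?\<gamma>)\<^sup>2"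
      by (simp add: a_const_def)
    ultimately show ?thesis
      by (simp add: c0_def)
  qed
  have b_const: "c1 * ((l + 2) / 2) = b_const l"
  proof -
    have "(2::real) powr (2 * ?\<gamma>) = 2 * 2 powr (2 * ?\<gamma> - 1)"
      using powr_add[of 2 1 "2 * ?\<gamma> - 1"] by simp
    then show ?thesis
      by (simp add: c1_def b_const_def)
  qed
  have eq0: "t_deriv (t_deriv (K0 l v)) (x0, t) - t powr l *\<^sub>R diff_op m a (K0 l v) (x0, t) =
       (a_const l * t powr (l / 2 - 1)) *\<^sub>R extended_value D (t_deriv v) (x0, 0)"
    if "t \<in> {0<..<t0}" for t
  proof -
    have "2 * 0 * t + c0 * (l / 2) = ?\<gamma> * (l + 2) * c0" for t :: real
      unfolding \<gamma>_l by simp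
    from mean_transform_equation[OF \<gamma>(1) v _ this assms(6) that assms(9), of c0] a_const
    show ?thesis by (simp add: K0 w_def[abs_def])
  qed
  have eq1: "t_deriv (t_deriv (K1 l v)) (x0, t) - t powr l *\<^sub>R diff_op m a (K1 l v) (x0, t) =
       (b_const l * t powr (l / 2)) *\<^sub>R extended_value D (t_deriv v) (x0, 0)"
    if "t \<in> {0<..<t0}" for t
  proof -
    have "(1 - ?\<gamma>) * (l + 2) = l / 2 + 2"
      using \<gamma>_l by (simp add: algebra_simps)
    then have "2 * c1 * t + (c1 * t) * (l / 2) = (1 - ?\<gamma>) * (l + 2) * (c1 * t)" for t :: real
      by (simp only:) (simp add: algebra_simps)
    from mean_transform_equation[OF _ v _ this assms(6) that assms(9), of 0] \<gamma>
    have "t_deriv (t_deriv (K1 l v)) (x0, t) - t powr l *\<^sub>R diff_op m a (K1 l v) (x0, t) =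
        (c1 * t * ((l + 2) / 2) * t powr (l / 2 - 1)) *\<^sub>R extended_value D (t_deriv v) (x0, 0)"
      by (simp add: K1 w_def[abs_def])
    moreover have "c1 * t * ((l + 2) / 2) * t powr (l / 2 - 1) = b_const l * t powr (l / 2)"
      using that by (simp add: powr_diff flip: b_const)
    ultimately show ?thesis by simp
  qed
  have w0: "w ?\<gamma> absolutely_integrable_on {0<..<1}" and w1: "w (1 - ?\<gamma>) absolutely_integrable_on {0<..<1}"
    using \<gamma> by (auto intro!: w)
  have "C_m_2_on m \<Omega> (K0 l v)" "C_m_2_on m \<Omega> (K1 l v)"
    using mean_transform_C_m_2[OF w0 v, of "\<lambda>t. c0" c0 0]
      mean_transform_C_m_2[OF w1 v, of "\<lambda>t. c1 * t" 0 c1]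
    by (simp_all add: K0 K1)
  moreover have "(K0 l v \<longlongrightarrow> extended_value D v (x0, 0)) (at (x0, 0) within \<Omega>)"
    "(t_deriv (K0 l v) \<longlongrightarrow> 0) (at (x0, 0) within \<Omega>)"
    using mean_transform_initial_values[OF w0 v _ assms(6), of "\<lambda>t. c0" c0 0] c0
    by (simp_all add: K0)
  moreover have "(K1 l v \<longlongrightarrow> 0) (at (x0, 0) within \<Omega>)"
    "(t_deriv (K1 l v) \<longlongrightarrow> extended_value D v (x0, 0)) (at (x0, 0) within \<Omega>)"
    using mean_transform_initial_values[OF w1 v _ assms(6), of "\<lambda>t. c1 * t" 0 c1] c1
    by (simp_all add: K1)
  ultimately show ?thesis
    using eq0 eq1 by blast
qed

end
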